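(* Let $k\ge 2$ and let $X$ be a $k$-step, $k$-ergodic groupspace. Then $X$ is isomorphic to $\mathcal{D}_k(A)$ for some abelian group $A$.
   Context: Notation: $[n]=\{1,\dots,n\}$; $\{0,1\}^0$ is a one point set; $1^n$ is the all-one vector; $\{0,1\}^n_*=\{0,1\}^n\setminus\{1^n\}$; $h(v)=\sum_i v_i$. $\mathcal{G}$-morphisms: a map $\phi:\{0,1\}^n\to\{0,1\}^m$ is a morphism in $\mathcal{G}$ if for every $i\in[m]$ the function $v\mapsto\phi(v)_i$ is either constant (then put $\gamma_\phi(i)=0$) or equal to $v\mapsto v_j$ or $v\mapsto 1-v_j$ for some $j\in[n]$ (then put $\gamma_\phi(i)=j$), and for all $1\le i<j\le m$ either $\gamma_\phi(j)=0$ or $\gamma_\phi(i)\le\gamma_\phi(j)$. For $i\in[n]$, $j\in\{0,1\}$ the face embedding $e^n_{i,j}:\{0,1\}^{n-1}\to\{0,1\}^n$ is $e^n_{i,j}(x_1,\dots,x_{n-1})=(x_1,\dots,x_{i-1},j,x_i,\dots,x_{n-1})$. A cube-structure is a set $X$ with subsets $C^n(X)\subseteq X^{\{0,1\}^n}$ for $n=0,1,2,\dots$. It is a groupspace if: (presheaf) $\psi\in C^m(X)$ and $\phi:\{0,1\}^n\to\{0,1\}^m$ a morphism in $\mathcal{G}$ imply $\psi\circ\phi\in C^n(X)$; (ergodicity) $C^1(X)=X^{\{0,1\}}$; (completion) for every $n\ge 0$, if $f:\{0,1\}^n_*\to X$ satisfies $f\circ e^n_{i,0}\in C^{n-1}(X)$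 for all $i\in[n]$, then some $\phi\in C^n(X)$ restricts to $f$ on $\{0,1\}^n_*$. A groupspace is $k$-step if for $n=k+1$ the completion $\phi$ is always uniquely determined by $f$. It is $k$-ergodic if $C^k(X)=X^{\{0,1\}^k}$. Two cube-structures are isomorphic if there is a bijection $m$ between them such that, for all $n$, $c$ is an $n$-cube of the first if and only if $m\circ c$ is an $n$-cube of the second. For an abelian group $A$ and $k\ge1$, $\mathcal{D}_k(A)$ is the cube-structure on $A$ whose $n$-cubes are the maps $f:\{0,1\}^n\to A$ such that $\sum_{u\le v}(-1)^{h(u)}f(u)=0$ for every $v\in\{0,1\}^n$ with $h(v)\ge k+1$ (the sum is over $u\in\{0,1\}^n$ with $u_i\le v_i$ for all $i$). *)

theory Defs
  imports "HOL-Algebra.FiniteProduct"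
begin

text \<open>Vectors are extensional functions on the index set \<open>{1..n}\<close>, so coordinates are numbered
  from 1 and \<open>vertices 0\<close> has exactly one element. Maps out of \<open>{0,1}\<^sup>n\<close> are extensional functions
  on \<open>vertices n\<close>, so that equality of maps is equality in HOL.\<close>

definition vertices :: "nat \<Rightarrow> (nat \<Rightarrow> nat) set" where
  "vertices n = {1..n} \<rightarrow>\<^sub>E {0, 1}"

definition all_one :: "nat \<Rightarrow> nat \<Rightarrow> nat" where
  "all_one n = (\<lambda>i\<in>{1..n}. 1)"

definition punctured_vertices :: "nat \<Rightarrow> (nat \<Rightarrow> nat) set" where
  "punctured_vertices n = vertices n - {all_one n}"

definition height :: "nat \<Rightarrow> (nat \<Rightarrow> nat) \<Rightarrow> nat" where
  "height n v = (\<Sum>i\<in>{1..n}. v i)"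

text \<open>The function \<open>\<gamma>\<close> is existentially quantified, but it is determined by \<open>\<phi>\<close> on \<open>{1..m}\<close>.\<close>

definition cube_morphism :: "nat \<Rightarrow> nat \<Rightarrow> ((nat \<Rightarrow> nat) \<Rightarrow> (nat \<Rightarrow> nat)) \<Rightarrow> bool" where
  "cube_morphism n m \<phi> \<longleftrightarrow>
     \<phi> \<in> vertices n \<rightarrow> vertices m \<and>
     (\<exists>\<gamma> :: nat \<Rightarrow> nat.
        (\<forall>i\<in>{1..m}.
           (\<gamma> i = 0 \<and> (\<exists>c. \<forall>v\<in>vertices n. \<phi> v i = c)) \<or>
           (\<gamma> i \<in> {1..n} \<and>
             ((\<forall>v\<in>vertices n. \<phi> v i = v (\<gamma> i)) \<or> (\<forall>v\<in>vertices n. \<phi> v i = 1 - v (\<gamma> i))))) \<and>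
        (\<forall>i j. 1 \<le> i \<and> i < j \<and> j \<le> m \<longrightarrow> \<gamma> j = 0 \<or> \<gamma> i \<le> \<gamma> j))"

definition face :: "nat \<Rightarrow> nat \<Rightarrow> nat \<Rightarrow> (nat \<Rightarrow> nat) \<Rightarrow> (nat \<Rightarrow> nat)" where
  "face n i j x = (\<lambda>l\<in>{1..n}. if l < i then x l else if l = i then j else x (l - 1))"

locale cube_structure =
  fixes X :: "'a set" and C :: "nat \<Rightarrow> ((nat \<Rightarrow> nat) \<Rightarrow> 'a) set"
  assumes cubes_subset: "C n \<subseteq> vertices n \<rightarrow>\<^sub>E X"

definition corner ::
  "'a set \<Rightarrow> (nat \<Rightarrow> ((nat \<Rightarrow> nat) \<Rightarrow> 'a) set) \<Rightarrow> nat \<Rightarrow> ((nat \<Rightarrow> nat) \<Rightarrow> 'a) \<Rightarrow> bool" where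
  "corner X C n f \<longleftrightarrow>
     f \<in> punctured_vertices n \<rightarrow>\<^sub>E X \<and>
     (\<forall>i\<in>{1..n}. compose (vertices (n - 1)) f (face n i 0) \<in> C (n - 1))"

definition completes ::
  "(nat \<Rightarrow> ((nat \<Rightarrow> nat) \<Rightarrow> 'a) set) \<Rightarrow> nat \<Rightarrow> ((nat \<Rightarrow> nat) \<Rightarrow> 'a) \<Rightarrow> ((nat \<Rightarrow> nat) \<Rightarrow> 'a) \<Rightarrow> bool"
  where "completes C n f \<phi> \<longleftrightarrow> \<phi> \<in> C n \<and> restrict \<phi> (punctured_vertices n) = f"

definition k_ergodic :: "nat \<Rightarrow> 'a set \<Rightarrow> (nat \<Rightarrow> ((nat \<Rightarrow> nat) \<Rightarrow> 'a) set) \<Rightarrow> bool" where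
  "k_ergodic k X C \<longleftrightarrow> C k = vertices k \<rightarrow>\<^sub>E X"

locale groupspace = cube_structure +
  assumes presheaf:
      "\<psi> \<in> C m \<Longrightarrow> cube_morphism n m \<phi> \<Longrightarrow> compose (vertices n) \<psi> \<phi> \<in> C n"
    and ergodicity: "k_ergodic 1 X C"
    and completion: "corner X C n f \<Longrightarrow> \<exists>\<phi>. completes C n f \<phi>"

definition k_step :: "nat \<Rightarrow> 'a set \<Rightarrow> (nat \<Rightarrow> ((nat \<Rightarrow> nat) \<Rightarrow> 'a) set) \<Rightarrow> bool" where
  "k_step k X C \<longleftrightarrow> (\<forall>f. corner X C (k + 1) f \<longrightarrow> (\<exists>!\<phi>. completes C (k + 1) f \<phi>))"

definition cube_isomorphic ::
  "'a set \<Rightarrow> (nat \<Rightarrow> ((nat \<Rightarrow> nat) \<Rightarrow> 'a) set) \<Rightarrow>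
   'b set \<Rightarrow> (nat \<Rightarrow> ((nat \<Rightarrow> nat) \<Rightarrow> 'b) set) \<Rightarrow> bool" where
  "cube_isomorphic X C Y D \<longleftrightarrow>
     (\<exists>m. bij_betw m X Y \<and>
        (\<forall>n. \<forall>c \<in> vertices n \<rightarrow>\<^sub>E X. c \<in> C n \<longleftrightarrow> compose (vertices n) m c \<in> D n))"

text \<open>The cubes of \<open>\<D>\<^sub>k(A)\<close>, whose underlying set is \<open>carrier A\<close>. The group is written
  multiplicatively, so \<open>(-1)\<^sup>h f(u)\<close> becomes the integer power of \<open>f u\<close> with exponent \<open>(-1)\<^sup>h\<close>.\<close>

definition abelian_cubes ::
  "nat \<Rightarrow> ('a, 'b) monoid_scheme \<Rightarrow> nat \<Rightarrow> ((nat \<Rightarrow> nat) \<Rightarrow> 'a) set" where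
  "abelian_cubes k A n =
     {f \<in> vertices n \<rightarrow>\<^sub>E carrier A.
        \<forall>v\<in>vertices n. height n v \<ge> k + 1 \<longrightarrow>
          finprod A (\<lambda>u. f u [^]\<^bsub>A\<^esub> ((- 1) ^ height n u :: int))
            {u \<in> vertices n. \<forall>i\<in>{1..n}. u i \<le> v i} = \<one>\<^bsub>A\<^esub>}"

end

theory Submission
  imports Defs
begin

text \<open>Since the structure is \<open>k\<close>-ergodic, a \<open>(k + 1)\<close>-cube is a pair of arbitrary maps
  \<open>{0,1}\<^sup>k \<rightarrow> X\<close>, one on each of the two faces in the last direction. Completing
  \<open>(k + 2)\<close>-corners shows that \<open>(k + 1)\<close>-cubes can be glued in every direction. Gluing in the last
  direction makes ``the pair is a cube'' an equivalence relation, and being \<open>k\<close>-step identifies its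
  classes with \<open>X\<close>: every map is equivalent to exactly one map that is constantly \<open>e\<close> off
  the top vertex. Gluing in any other direction \<open>j\<close> induces a group law on the classes. A map with only
  two values different from \<open>e\<close> can be cut along either of two directions; comparing the cuts
  gives, as in the Eckmann-Hilton argument, that all these laws agree and are commutative (this is
  where \<open>k \<ge> 2\<close> enters). Cutting a map into its single values then shows that its class is the
  alternating sum, so the alternating sum of a \<open>(k + 1)\<close>-cube vanishes. In dimensions above
  \<open>k + 1\<close> both cube structures are determined by faces, because the top value of a cube of
  \<open>\<D>\<^sub>k(A)\<close> is determined by the others.\<close>

section \<open>Congruences on discrete cubes\<close>

text \<open>In this section \<open>{0,1}\<^sup>K\<close> is encoded as \<open>Pow K\<close>, a vertex being the set of its
  coordinates equal to 1. A relation \<open>R f g\<close> stands for the cube with opposite faces \<open>f\<close> and \<open>g\<close>.\<close>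

definition glue :: "'i \<Rightarrow> ('i set \<Rightarrow> 'a) \<Rightarrow> ('i set \<Rightarrow> 'a) \<Rightarrow> 'i set \<Rightarrow> 'a" where
  "glue j f g = (\<lambda>S. if j \<in> S then g S else f S)"

text \<open>Axioms abstracted from a cube cut into two opposite faces over \<open>K\<close>. The
  base point \<open>e\<close> is arbitrary and becomes the neutral element. In
  \<open>R_complete\<close> the free vertex \<open>V\<close> may be any vertex, which allows every
  class to be reached by moving one chosen value.\<close>

locale cube_congruence =
  fixes K :: "'i set" and X :: "'a set" and e :: 'a
    and R :: "('i set \<Rightarrow> 'a) \<Rightarrow> ('i set \<Rightarrow> 'a) \<Rightarrow> bool"
  assumes finite_K: "finite K"
    and e_in: "e \<in> X"
    and R_refl: "\<lbrakk>f \<in> Pow K \<rightarrow> X; \<And>S. S \<subseteq> K \<Longrightarrow> f S = g S\<rbrakk> \<Longrightarrow> R f g"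
    and R_sym: "R f g \<Longrightarrow> R g f"
    and R_trans: "\<lbrakk>R f g; R g h\<rbrakk> \<Longrightarrow> R f h"
    and R_complete: "\<lbrakk>f \<in> Pow K \<rightarrow> X; g \<in> Pow K \<rightarrow> X; V \<subseteq> K\<rbrakk> \<Longrightarrow> \<exists>!x. x \<in> X \<and> R f (g(V := x))"
    and R_glue: "\<lbrakk>j \<in> K; R f f'; R g g';
        \<And>S. S \<subseteq> K \<Longrightarrow> f (insert j S) = g (S - {j});
        \<And>S. S \<subseteq> K \<Longrightarrow> f' (insert j S) = g' (S - {j})\<rbrakk> \<Longrightarrow> R (glue j f g) (glue j f' g')"
    and R_degenerate: "\<lbrakk>j \<in> K; f \<in> Pow K \<rightarrow> X; g \<in> Pow K \<rightarrow> X;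
        \<And>S. S \<subseteq> K \<Longrightarrow> f S = f (S - {j}); \<And>S. S \<subseteq> K \<Longrightarrow> g S = g (S - {j})\<rbrakk> \<Longrightarrow> R f g"
begin

definition single :: "'i set \<Rightarrow> 'a \<Rightarrow> 'i set \<Rightarrow> 'a" where
  "single V x = (\<lambda>S. if S = V then x else e)"

definition T :: "('i set \<Rightarrow> 'a) \<Rightarrow> 'a" where
  "T f = (THE x. x \<in> X \<and> R f (single K x))"

definition composable :: "'i \<Rightarrow> ('i set \<Rightarrow> 'a) \<Rightarrow> ('i set \<Rightarrow> 'a) \<Rightarrow> bool" where
  "composable j f g \<longleftrightarrow> f \<in> Pow K \<rightarrow> X \<and> g \<in> Pow K \<rightarrow> X \<and>
     (\<forall>S. S \<subseteq> K \<longrightarrow> f (insert j S) = g (S - {j}))"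

text \<open>Concatenation along \<open>j\<close>, carried over to the names of the classes. That the
  outcome does not depend on the representatives is part of \<open>add_T\<close>.\<close>

definition add :: "'i \<Rightarrow> 'a \<Rightarrow> 'a \<Rightarrow> 'a" where
  "add j x y = (THE z. \<exists>f g. composable j f g \<and> T f = x \<and> T g = y \<and> z = T (glue j f g))"

lemma single_in: "x \<in> X \<Longrightarrow> single V x \<in> Pow K \<rightarrow> X"
  using e_in by (auto simp: single_def)

lemma const_in: "(\<lambda>_. e) \<in> Pow K \<rightarrow> X"
  using e_in by auto

lemma upd_in: "\<lbrakk>f \<in> Pow K \<rightarrow> X; x \<in> X\<rbrakk> \<Longrightarrow> f(V := x) \<in> Pow K \<rightarrow> X"
  by (simp add: Pi_def)

lemma glue_in: "composable j f g \<Longrightarrow> glue j f g \<in> Pow K \<rightarrow> X"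
  by (auto simp: composable_def glue_def Pi_def)

lemma single_eq_upd: "single V x = (\<lambda>_. e)(V := x)"
  by (auto simp: single_def)

lemma T_unique:
  assumes "f \<in> Pow K \<rightarrow> X"
  shows "\<exists>!x. x \<in> X \<and> R f (single K x)"
  using R_complete[OF assms const_in order.refl] by (simp add: single_eq_upd)

lemma T_props:
  assumes "f \<in> Pow K \<rightarrow> X"
  shows "T f \<in> X" "R f (single K (T f))"
  using theI'[OF T_unique[OF assms]] by (auto simp: T_def)

lemma T_eqI:
  assumes "f \<in> Pow K \<rightarrow> X" "x \<in> X" "R f (single K x)"
  shows "T f = x"
  using T_unique[OF assms(1)] T_props[OF assms(1)] assms by blast

lemma T_eq_iff:
  assumes "f \<in> Pow K \<rightarrow> X" "g \<in> Pow K \<rightarrow> X"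
  shows "T f = T g \<longleftrightarrow> R f g"
proof
  assume "T f = T g"
  then show "R f g" using T_props[OF assms(1)] T_props[OF assms(2)] R_sym R_trans by metis
next
  assume "R f g"
  then show "T f = T g" using T_props[OF assms(2)] T_eqI[OF assms(1)] R_trans by metis
qed

lemma T_cong:
  assumes "f \<in> Pow K \<rightarrow> X" "\<And>S. S \<subseteq> K \<Longrightarrow> f S = g S"
  shows "T f = T g"
proof -
  have "g \<in> Pow K \<rightarrow> X" using assms by (auto simp: Pi_def)
  with assms show ?thesis using T_eq_iff R_refl by metis
qed

lemma T_single_top: "x \<in> X \<Longrightarrow> T (single K x) = x"
  by (intro T_eqI R_refl single_in) auto

text \<open>\<open>R_degenerate\<close> relates \<open>f\<close> to the constant map
  \<open>e\<close>, and that map agrees with \<open>single K e\<close>.\<close>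

lemma T_degenerate:
  assumes "j \<in> K" "f \<in> Pow K \<rightarrow> X" "\<And>S. S \<subseteq> K \<Longrightarrow> f S = f (S - {j})"
  shows "T f = e"
proof -
  have "T f = T (\<lambda>_. e)"
    using R_degenerate[OF assms(1,2) const_in assms(3)] T_eq_iff[OF assms(2) const_in] by auto
  also have "\<dots> = T (single K e)"
    by (rule T_cong[OF const_in]) (simp add: single_def)
  finally show ?thesis using T_single_top[OF e_in] by simp
qed

text \<open>\<open>R_complete\<close> read backwards: the class is prescribed through its
  representative \<open>single K x\<close>, and the free value of \<open>g\<close> at
  \<open>V\<close> is solved for.\<close>

lemma T_surj:
  assumes "g \<in> Pow K \<rightarrow> X" "V \<subseteq> K" "x \<in> X"
  obtains u where "u \<in> X" "g(V := u) \<in> Pow K \<rightarrow> X" "T (g(V := u)) = x"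
proof -
  obtain u where u: "u \<in> X" "R (single K x) (g(V := u))"
    using R_complete[OF single_in[OF assms(3)] assms(1,2)] by blast
  moreover have "g(V := u) \<in> Pow K \<rightarrow> X" by (rule upd_in[OF assms(1) u(1)])
  ultimately show ?thesis
    using that T_eq_iff[OF single_in[OF assms(3)]] T_single_top[OF assms(3)] by metis
qed

text \<open>The lower face of \<open>g\<close> in direction \<open>j\<close> is forced by
  \<open>f\<close>, but the top vertex \<open>K\<close> lies on the upper face, so its value is free
  and can be adjusted to reach any class.\<close>

lemma composable_exists:
  assumes "j \<in> K" "f \<in> Pow K \<rightarrow> X" "y \<in> X"
  obtains g where "composable j f g" "T g = y"
proof -
  let ?g = "\<lambda>S. f (insert j S)"
  have "?g \<in> Pow K \<rightarrow> X" using assms by auto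
  from T_surj[OF this order.refl assms(3)] obtain u where
    u: "u \<in> X" "?g(K := u) \<in> Pow K \<rightarrow> X" "T (?g(K := u)) = y" .
  moreover have "composable j f (?g(K := u))"
    unfolding composable_def using u(2) assms(1,2) by auto
  ultimately show ?thesis using that by blast
qed

text \<open>Equal names mean related maps by \<open>T_eq_iff\<close>, and \<open>R_glue\<close> says
  that gluing respects \<open>R\<close>.\<close>

lemma add_T:
  assumes j: "j \<in> K" and fg: "composable j f g"
  shows "add j (T f) (T g) = T (glue j f g)"
  unfolding add_def
proof (rule the_equality)
  show "\<exists>f' g'. composable j f' g' \<and> T f' = T f \<and> T g' = T g \<and> T (glue j f g) = T (glue j f' g')"
    using fg by blast
next
  fix z
  assume "\<exists>f' g'. composable j f' g' \<and> T f' = T f \<and> T g' = T g \<and> z = T (glue j f' g')"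
  then obtain f' g' where h: "composable j f' g'" "T f' = T f" "T g' = T g" "z = T (glue j f' g')"
    by blast
  have "R (glue j f' g') (glue j f g)"
    using h fg T_eq_iff unfolding composable_def by (intro R_glue j) auto
  then show "z = T (glue j f g)" using h(4) T_eq_iff glue_in h(1) fg by metis
qed

lemma obtain_composable:
  assumes "j \<in> K" "x \<in> X" "y \<in> X"
  obtains f g where "composable j f g" "T f = x" "T g = y"
  using composable_exists[OF assms(1) single_in[OF assms(2)] assms(3)] T_single_top[OF assms(2)]
  by metis

lemma add_closed: "\<lbrakk>j \<in> K; x \<in> X; y \<in> X\<rbrakk> \<Longrightarrow> add j x y \<in> X"
  by (metis obtain_composable add_T T_props(1) glue_in)

text \<open>Three maps in a row along \<open>j\<close> realise \<open>x\<close>, \<open>y\<close>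
  and \<open>z\<close>. Both bracketings glue to literally the same map, made of the lower face of
  the first and the upper face of the last.\<close>

lemma add_assoc:
  assumes j: "j \<in> K" and "x \<in> X" "y \<in> X" "z \<in> X"
  shows "add j (add j x y) z = add j x (add j y z)"
proof -
  obtain f g where fg: "composable j f g" "T f = x" "T g = y"
    using obtain_composable assms by metis
  obtain h where gh: "composable j g h" "T h = z"
    using composable_exists[OF j, of g z] fg(1) assms(4) unfolding composable_def by metis
  have 1: "composable j (glue j f g) h"
    using fg(1) gh(1) glue_in[OF fg(1)] unfolding composable_def by (auto simp: glue_def)
  have 2: "composable j f (glue j g h)"
    using fg(1) gh(1) glue_in[OF gh(1)] unfolding composable_def by (auto simp: glue_def)
  have "glue j (glue j f g) h = glue j f (glue j g h)" by (auto simp: glue_def)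
  then show ?thesis using add_T[OF j] fg gh 1 2 by metis
qed

text \<open>The lower face of \<open>single K x\<close> is constantly \<open>e\<close>, so gluing
  the constant map in front of it changes nothing.\<close>

lemma add_e_left:
  assumes j: "j \<in> K" and x: "x \<in> X"
  shows "add j e x = x"
proof -
  have "composable j (\<lambda>_. e) (single K x)"
    unfolding composable_def using j single_in[OF x] const_in by (auto simp: single_def)
  moreover have "glue j (\<lambda>_. e) (single K x) = single K x"
    using j by (auto simp: glue_def single_def)
  ultimately show ?thesis
    using add_T[OF j] T_degenerate[OF j const_in] T_single_top[OF x] by metis
qed

text \<open>Reflection in direction \<open>j\<close> gives the inverse: a map preceded by its mirror
  image glues to a map that ignores \<open>j\<close>, and the class of such a map is
  \<open>e\<close>.\<close>

lemma left_inverse: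
  assumes j: "j \<in> K" and x: "x \<in> X"
  obtains y where "y \<in> X" "add j y x = e"
proof -
  define f where "f = single K x"
  define g where "g = (\<lambda>S. if j \<in> S then f (S - {j}) else f (insert j S))"
  have f: "f \<in> Pow K \<rightarrow> X" using single_in[OF x] by (simp add: f_def)
  have g: "g \<in> Pow K \<rightarrow> X" using x e_in by (simp add: g_def f_def single_def)
  have c: "composable j g f"
    unfolding composable_def using f g by (simp add: g_def)
  have "T (glue j g f) = e"
    by (rule T_degenerate[OF j glue_in[OF c]]) (simp add: glue_def g_def insert_absorb)
  then have "add j (T g) x = e" using add_T[OF j c] T_single_top[OF x] by (simp add: f_def)
  then show ?thesis using that T_props(1)[OF g] by blast
qed

text \<open>A face that is constantly \<open>e\<close> is inserted between the two halves of
  \<open>f\<close>; this makes the halves composable, and gluing them gives \<open>f\<close>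
  back.\<close>

lemma T_split:
  assumes j: "j \<in> K" and f: "f \<in> Pow K \<rightarrow> X"
  shows "T f = add j (T (\<lambda>S. if j \<in> S then e else f S)) (T (\<lambda>S. if j \<in> S then f S else e))"
proof -
  let ?g = "\<lambda>S. if j \<in> S then e else f S" and ?h = "\<lambda>S. if j \<in> S then f S else e"
  have "composable j ?g ?h" using f e_in by (auto simp: composable_def)
  moreover have "glue j ?g ?h = f" by (auto simp: glue_def)
  ultimately show ?thesis using add_T[OF j] by metis
qed

lemma T_single_surj:
  assumes "V \<subseteq> K" "x \<in> X"
  obtains u where "u \<in> X" "T (single V u) = x"
  using T_surj[OF const_in assms] by (metis single_eq_upd)

lemma add_independent:
  assumes j: "j \<in> K" and i: "i \<in> K" and x: "x \<in> X" and y: "y \<in> X"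
  shows "add j x y = add i x y"
proof -
  obtain u where u: "u \<in> X" "T (single (K - {i,j}) u) = x"
    using T_single_surj[OF _ x, of "K - {i,j}"] by blast
  \<comment> \<open>Cutting \<open>?h\<close> along \<open>i\<close> or along \<open>j\<close> gives the same two pieces.\<close>
  let ?h = "(single K y)(K - {i,j} := u)"
  have h: "?h \<in> Pow K \<rightarrow> X" by (rule upd_in[OF single_in[OF y] u(1)])
  have *: "T ?h = add l x y" if l: "l = i \<or> l = j" for l
  proof -
    have lK: "l \<in> K" using l i j by auto
    have "(\<lambda>S. if l \<in> S then e else ?h S) = single (K - {i,j}) u"
      using l i j by (auto simp: single_def fun_eq_iff)
    moreover have "(\<lambda>S. if l \<in> S then ?h S else e) = single K y"
      using l i j by (auto simp: single_def fun_eq_iff)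
    ultimately show ?thesis
      using T_split[OF lK h] u(2) T_single_top[OF y] by simp
  qed
  show ?thesis using *[of i] *[of j] by simp
qed

lemma add_commute_distinct:
  assumes j: "j \<in> K" and i: "i \<in> K" and ij: "i \<noteq> j" and x: "x \<in> X" and y: "y \<in> X"
  shows "add j x y = add j y x"
proof -
  obtain u where u: "u \<in> X" "T (single (K - {j}) u) = x"
    using T_single_surj[OF _ x, of "K - {j}"] by blast
  obtain w where w: "w \<in> X" "T (single (K - {i}) w) = y"
    using T_single_surj[OF _ y, of "K - {i}"] by blast
  have ne: "K - {j} \<noteq> K - {i}" using i j ij by blast
  \<comment> \<open>Cutting \<open>?h\<close> along \<open>i\<close> gives the pieces of the cut along \<open>j\<close> in the opposite order.\<close>
  let ?h = "(single (K - {j}) u)(K - {i} := w)"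
  have h: "?h \<in> Pow K \<rightarrow> X" by (rule upd_in[OF single_in[OF u(1)] w(1)])
  have "(\<lambda>S. if j \<in> S then e else ?h S) = single (K - {j}) u"
    "(\<lambda>S. if j \<in> S then ?h S else e) = single (K - {i}) w"
    "(\<lambda>S. if i \<in> S then e else ?h S) = single (K - {i}) w"
    "(\<lambda>S. if i \<in> S then ?h S else e) = single (K - {j}) u"
    using i j ij ne by (auto simp: single_def fun_eq_iff)
  then have "add j x y = add i y x"
    using T_split[OF j h] T_split[OF i h] u(2) w(2) by simp
  then show ?thesis using add_independent[OF i j y x] by simp
qed

section \<open>The commutative group on the classes and the alternating sum formula\<close>

definition grp :: "'i \<Rightarrow> 'a monoid" where
  "grp j = \<lparr>carrier = X, mult = add j, one = e\<rparr>"

lemma grp_simps [simp]: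
  "carrier (grp j) = X" "mult (grp j) = add j" "one (grp j) = e"
  by (auto simp: grp_def)

lemma comm_group_grp:
  assumes j: "j \<in> K" and i: "i \<in> K" and ij: "i \<noteq> j"
  shows "comm_group (grp j)"
proof -
  have "group (grp j)"
  proof (rule groupI)
    fix x assume "x \<in> carrier (grp j)"
    then obtain y where "y \<in> X" "add j y x = e" using left_inverse[OF j] by auto
    then show "\<exists>y\<in>carrier (grp j). y \<otimes>\<^bsub>grp j\<^esub> x = \<one>\<^bsub>grp j\<^esub>" by auto
  qed (simp_all add: add_closed[OF j] add_assoc[OF j] add_e_left[OF j] e_in)
  then show ?thesis
  proof (rule group.group_comm_groupI)
    fix x y assume "x \<in> carrier (grp j)" "y \<in> carrier (grp j)"
    then show "x \<otimes>\<^bsub>grp j\<^esub> y = y \<otimes>\<^bsub>grp j\<^esub> x"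
      unfolding grp_simps by (rule add_commute_distinct[OF j i ij])
  qed
qed

text \<open>Moving the exceptional vertex across an edge in direction \<open>i\<close> inverts the
  class, because the two single-valued maps glue along \<open>i\<close> to the constant map
  \<open>e\<close>. The number of edges between \<open>V\<close> and the top vertex \<open>K\<close>
  therefore gives the sign.\<close>

lemma T_single:
  assumes j: "j \<in> K" and cg: "comm_group (grp j)" and u: "u \<in> X" and "V \<subseteq> K"
  shows "T (single V u) = u [^]\<^bsub>grp j\<^esub> ((-1) ^ card (K - V) :: int)"
  using \<open>V \<subseteq> K\<close>
proof (induction "card (K - V)" arbitrary: V)
  case 0
  then have "K - V = {}" using finite_K by (metis card_0_eq finite_Diff)
  then have "V = K" using 0(2) by blast
  have "u [^]\<^bsub>grp j\<^esub> (1::int) = u"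
    using group.int_pow_1[OF comm_group.axioms(2)[OF cg], of u] u by (simp only: grp_simps)
  then show ?case
    by (simp only: \<open>V = K\<close> Diff_cancel card.empty power_0 T_single_top[OF u])
next
  case (Suc n)
  interpret comm_group "grp j" by (rule cg)
  from Suc(2) obtain i where i: "i \<in> K" "i \<notin> V"
    by (metis Diff_iff card.empty ex_in_conv nat.distinct(1))
  have n: "n = card (K - insert i V)"
  proof -
    have "K - V = insert i (K - insert i V)" using i by auto
    then have "card (K - V) = card (insert i (K - insert i V))" by (rule arg_cong)
    also have "\<dots> = Suc (card (K - insert i V))" using finite_K by (intro card_insert_disjoint) auto
    finally have "card (K - V) = Suc (card (K - insert i V))" .
    then show ?thesis using Suc(2) by simp
  qed
  let ?f = "single (insert i V) u" and ?g = "single V u"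
  have "?f (insert i S) = ?g (S - {i})" for S
  proof -
    have "insert i S = insert i V \<longleftrightarrow> S - {i} = V"
      using insert_ident[of i "S - {i}" V] i by simp
    then show ?thesis by (simp only: single_def)
  qed
  then have c: "composable i ?f ?g"
    unfolding composable_def using single_in[OF u] by blast
  have "glue i ?f ?g = (\<lambda>_. e)" using i by (intro ext) (auto simp: glue_def single_def)
  then have "add i (T ?f) (T ?g) = e"
    using add_T[OF i(1) c] T_degenerate[OF i(1) const_in] by simp
  moreover have m: "T ?f \<in> X" "T ?g \<in> X" using T_props(1) single_in[OF u] by auto
  ultimately have "add j (T ?f) (T ?g) = e" using add_independent[OF i(1) j] by metis
  then have "T ?g \<otimes>\<^bsub>grp j\<^esub> T ?f = \<one>\<^bsub>grp j\<^esub>" using m_comm[unfolded grp_simps, OF m(2,1)] by (simp only: grp_simps)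
  then have "T ?g = inv\<^bsub>grp j\<^esub> (T ?f)" using m by (intro inv_equality[symmetric]) simp_all
  also have "T ?f = u [^]\<^bsub>grp j\<^esub> ((-1) ^ n :: int)"
    unfolding n by (rule Suc(1)[OF n]) (use Suc(3) i in blast)
  finally have "T ?g = u [^]\<^bsub>grp j\<^esub> (- ((-1) ^ n) :: int)"
    by (simp only: int_pow_neg[unfolded grp_simps, OF u])
  then show ?case unfolding Suc(2)[symmetric] by simp
qed

text \<open>The map is cut successively along the directions in a growing set \<open>L\<close>, with
  one piece for each trace \<open>B\<close> on \<open>L\<close>. Once \<open>L = K\<close> every
  piece carries a single value, and \<open>T_single\<close> evaluates it.\<close>

lemma T_eq_sum:
  assumes j: "j \<in> K" and cg: "comm_group (grp j)" and f: "f \<in> Pow K \<rightarrow> X"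
  shows "T f = finprod (grp j) (\<lambda>S. f S [^]\<^bsub>grp j\<^esub> ((-1) ^ card (K - S) :: int)) (Pow K)"
proof -
  interpret comm_group "grp j" by (rule cg)
  have fin: "(\<lambda>S. if S \<inter> L = B then f S else e) \<in> Pow K \<rightarrow> X" for L B
    using f e_in by (auto simp: Pi_def)
  have "T f = finprod (grp j) (\<lambda>B. T (\<lambda>S. if S \<inter> L = B then f S else e)) (Pow L)"
    if "finite L" "L \<subseteq> K" for L
    using that
  proof (induction L)
    case empty
    then show ?case using T_props(1)[OF f] r_one[of "T f", simplified] by simp
  next
    case (insert i L)
    let ?t = "\<lambda>L B. T (\<lambda>S. if S \<inter> L = B then f S else e)"
    have i: "i \<in> K" using insert by auto
    have tin: "?t L B \<in> X" for L B using T_props(1)[OF fin] .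
    have "T f = finprod (grp j) (?t L) (Pow L)" using insert by auto
    also have "\<dots> = finprod (grp j) (\<lambda>B. add j (?t (insert i L) B) (?t (insert i L) (insert i B))) (Pow L)"
    proof (rule finprod_cong')
      fix B assume "B \<in> Pow L"
      then have B: "B \<subseteq> L" by auto
      \<comment> \<open>Cutting the piece with trace \<open>B\<close> on \<open>L\<close> along the
        new direction \<open>i\<close> leaves the pieces with traces \<open>B\<close> and
        \<open>insert i B\<close> on \<open>insert i L\<close>.\<close>
      have 1: "(\<lambda>S. if i \<in> S then e else if S \<inter> L = B then f S else e)
          = (\<lambda>S. if S \<inter> insert i L = B then f S else e)"
        using B insert(2) by (intro ext) auto
      have 2: "(\<lambda>S. if i \<in> S then if S \<inter> L = B then f S else e else e)
          = (\<lambda>S. if S \<inter> insert i L = insert i B then f S else e)"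
      proof
        fix S
        have "S \<inter> insert i L = insert i B \<longleftrightarrow> i \<in> S \<and> S \<inter> L = B"
          using B insert(2) by auto
        then show "(if i \<in> S then if S \<inter> L = B then f S else e else e)
          = (if S \<inter> insert i L = insert i B then f S else e)" by auto
      qed
      show "?t L B = add j (?t (insert i L) B) (?t (insert i L) (insert i B))"
        using T_split[OF i fin, of L B] add_independent[OF i j tin tin] unfolding 1 2 by simp
    qed (use add_closed[OF j] tin in auto)
    also have "\<dots> = add j (finprod (grp j) (?t (insert i L)) (Pow L))
        (finprod (grp j) (\<lambda>B. ?t (insert i L) (insert i B)) (Pow L))"
      using finprod_multf[of "?t (insert i L)" "Pow L" "\<lambda>B. ?t (insert i L) (insert i B)"] tin by auto
    also have "finprod (grp j) (\<lambda>B. ?t (insert i L) (insert i B)) (Pow L)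
        = finprod (grp j) (?t (insert i L)) (insert i ` Pow L)"
    proof (rule finprod_reindex[symmetric])
      show "inj_on (insert i) (Pow L)"
        using insert(2) by (intro inj_onI) (metis PowD insert_ident subsetD)
    qed (use tin in auto)
    also have "add j (finprod (grp j) (?t (insert i L)) (Pow L)) \<dots>
        = finprod (grp j) (?t (insert i L)) (Pow (insert i L))"
      unfolding Pow_insert using insert(1,2) tin
      by (subst finprod_Un_disjoint) auto
    finally show ?case .
  qed
  from this[OF finite_K order.refl]
  have "T f = finprod (grp j) (\<lambda>B. T (\<lambda>S. if S \<inter> K = B then f S else e)) (Pow K)" .
  also have "\<dots> = finprod (grp j) (\<lambda>S. f S [^]\<^bsub>grp j\<^esub> ((-1) ^ card (K - S) :: int)) (Pow K)"
  proof (rule finprod_cong')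
    fix B assume "B \<in> Pow K"
    then have B: "B \<subseteq> K" "f B \<in> X" using f by auto
    have "T (\<lambda>S. if S \<inter> K = B then f S else e) = T (single B (f B))"
      by (rule T_cong[OF fin]) (auto simp: single_def Int_absorb2)
    then show "T (\<lambda>S. if S \<inter> K = B then f S else e) = f B [^]\<^bsub>grp j\<^esub> ((-1) ^ card (K - B) :: int)"
      using T_single[OF j cg B(2,1)] by simp
  qed (use f int_pow_closed in \<open>auto simp: Pi_def\<close>)
  finally show ?thesis .
qed

end

section \<open>Faces and morphisms\<close>

lemma vertices_01: "v \<in> vertices n \<Longrightarrow> i \<in> {1..n} \<Longrightarrow> v i = 0 \<or> v i = 1"
  by (auto simp: vertices_def PiE_iff)

lemma vertices_eqI:
  "\<lbrakk>u \<in> vertices n; v \<in> vertices n; \<And>i. i \<in> {1..n} \<Longrightarrow> u i = v i\<rbrakk> \<Longrightarrow> u = v"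
  unfolding vertices_def by (rule PiE_ext)

lemma restrict_in_vertices:
  "(\<And>i. i \<in> {1..n} \<Longrightarrow> f i = 0 \<or> f i = 1) \<Longrightarrow> (\<lambda>i\<in>{1..n}. f i) \<in> vertices n"
  by (auto simp: vertices_def)

lemma vertex_upd:
  "\<lbrakk>v \<in> vertices n; i \<in> {1..n}; a = 0 \<or> a = 1\<rbrakk> \<Longrightarrow> v(i := a) \<in> vertices n"
  by (auto simp: vertices_def PiE_iff extensional_def)

lemma all_one_in: "all_one n \<in> vertices n"
  unfolding all_one_def by (rule restrict_in_vertices) simp

lemma finite_vertices: "finite (vertices n)"
  unfolding vertices_def by (intro finite_PiE) auto

lemma not_all_one:
  assumes "v \<in> vertices n" "v \<noteq> all_one n"
  obtains i where "i \<in> {1..n}" "v i = 0"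
  using assms vertices_eqI[OF assms(1) all_one_in] vertices_01[OF assms(1)]
  by (auto simp: all_one_def)

lemma height_all_one: "height n (all_one n) = n"
  by (simp add: height_def all_one_def)

definition drop_coord :: "nat \<Rightarrow> nat \<Rightarrow> (nat \<Rightarrow> nat) \<Rightarrow> nat \<Rightarrow> nat" where
  "drop_coord n i w = (\<lambda>l\<in>{1..n}. if l < i then w l else w (Suc l))"

lemma drop_coord_in: "w \<in> vertices (Suc n) \<Longrightarrow> drop_coord n i w \<in> vertices n"
  unfolding drop_coord_def
proof (rule restrict_in_vertices)
  fix l assume "w \<in> vertices (Suc n)" "l \<in> {1..n}"
  then show "(if l < i then w l else w (Suc l)) = 0 \<or> (if l < i then w l else w (Suc l)) = 1"
    using vertices_01[of w "Suc n" l] vertices_01[of w "Suc n" "Suc l"] by auto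
qed

lemma face_in:
  "\<lbrakk>i \<in> {1..Suc n}; a = 0 \<or> a = 1; v \<in> vertices n\<rbrakk> \<Longrightarrow> face (Suc n) i a v \<in> vertices (Suc n)"
  unfolding face_def
proof (rule restrict_in_vertices)
  fix l assume *: "i \<in> {1..Suc n}" "a = 0 \<or> a = 1" "v \<in> vertices n" "l \<in> {1..Suc n}"
  show "(if l < i then v l else if l = i then a else v (l - 1)) = 0 \<or>
        (if l < i then v l else if l = i then a else v (l - 1)) = 1"
  proof (cases l i rule: linorder_cases)
    case greater
    then have "l - 1 \<in> {1..n}" using * by auto
    then show ?thesis using vertices_01[OF *(3)] greater by simp
  qed (use * vertices_01[OF *(3), of l] in auto)
qed

lemma face_at: "i \<in> {1..Suc n} \<Longrightarrow> face (Suc n) i a v i = a"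
  by (simp add: face_def)

lemma drop_coord_face:
  assumes "i \<in> {1..Suc n}" "v \<in> vertices n"
  shows "drop_coord n i (face (Suc n) i a v) = v"
proof (rule ext)
  fix l
  show "drop_coord n i (face (Suc n) i a v) l = v l"
    using assms by (cases "l \<in> {1..n}") (auto simp: drop_coord_def face_def vertices_def PiE_iff extensional_def)
qed

lemma face_drop_coord:
  assumes "i \<in> {1..Suc n}" "w \<in> vertices (Suc n)"
  shows "face (Suc n) i (w i) (drop_coord n i w) = w"
proof (rule ext)
  fix l
  show "face (Suc n) i (w i) (drop_coord n i w) l = w l"
    using assms by (cases "l \<in> {1..Suc n}") (auto simp: drop_coord_def face_def vertices_def PiE_iff extensional_def)
qed

lemma inj_on_face: "i \<in> {1..Suc n} \<Longrightarrow> inj_on (face (Suc n) i a) (vertices n)"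
  by (metis drop_coord_face inj_on_inverseI)

lemma face_image:
  assumes "i \<in> {1..Suc n}" "a = 0 \<or> a = 1"
  shows "face (Suc n) i a ` vertices n = {w \<in> vertices (Suc n). w i = a}"
proof (intro equalityI subsetI)
  fix w assume "w \<in> {w \<in> vertices (Suc n). w i = a}"
  then show "w \<in> face (Suc n) i a ` vertices n"
    using face_drop_coord[OF assms(1), of w] drop_coord_in[of w n i] by (auto intro: rev_image_eqI)
qed (use face_in[OF assms] face_at[OF assms(1)] in auto)

lemma face_all_one: "i \<in> {1..Suc n} \<Longrightarrow> face (Suc n) i a (all_one n) = (all_one (Suc n))(i := a)"
  by (auto simp: face_def all_one_def fun_eq_iff)

lemma height_face:
  assumes i: "i \<in> {1..Suc n}"
  shows "height (Suc n) (face (Suc n) i a v) = height n v + a"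
proof -
  let ?s = "\<lambda>l. if l < i then l else Suc l" and ?w = "face (Suc n) i a v"
  have s: "?s ` {1..n} = {1..Suc n} - {i}"
  proof (intro equalityI subsetI)
    fix l assume l: "l \<in> {1..Suc n} - {i}"
    show "l \<in> ?s ` {1..n}"
    proof (cases "l < i")
      case True
      then show ?thesis using l i by (intro rev_image_eqI[of l]) auto
    next
      case False
      then show ?thesis using l i by (intro rev_image_eqI[of "l - 1"]) auto
    qed
  qed (use i in \<open>auto split: if_splits\<close>)
  have inj: "inj_on ?s {1..n}" by (auto simp: inj_on_def)
  have "height (Suc n) ?w = ?w i + sum ?w ({1..Suc n} - {i})"
    unfolding height_def using i by (intro sum.remove) auto
  also have "sum ?w ({1..Suc n} - {i}) = (\<Sum>l\<in>{1..n}. ?w (?s l))"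
    unfolding s[symmetric] using sum.reindex[OF inj] by (simp add: o_def)
  also have "\<dots> = height n v"
    unfolding height_def using i by (intro sum.cong) (auto simp: face_def)
  finally show ?thesis using face_at[OF i] by simp
qed

section \<open>The morphisms in use: faces, reflections, setting a coordinate to zero, and
  unfolding\<close>

lemma cube_morphismI:
  assumes "\<And>v. v \<in> vertices n \<Longrightarrow> \<phi> v \<in> vertices m"
    and "\<And>i. i \<in> {1..m} \<Longrightarrow> (\<gamma> i = 0 \<and> (\<exists>c. \<forall>v\<in>vertices n. \<phi> v i = c)) \<or>
           (\<gamma> i \<in> {1..n} \<and>
             ((\<forall>v\<in>vertices n. \<phi> v i = v (\<gamma> i)) \<or> (\<forall>v\<in>vertices n. \<phi> v i = 1 - v (\<gamma> i))))"
    and "\<And>i j. \<lbrakk>1 \<le> i; i < j; j \<le> m\<rbrakk> \<Longrightarrow> \<gamma> j = 0 \<or> \<gamma> i \<le> \<gamma> j"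
  shows "cube_morphism n m \<phi>"
  unfolding cube_morphism_def
proof (intro conjI exI[of _ \<gamma>] ballI allI impI)
  fix i j assume "1 \<le> i \<and> i < j \<and> j \<le> m"
  then show "\<gamma> j = 0 \<or> \<gamma> i \<le> \<gamma> j" using assms(3) by blast
qed (use assms(1,2) in auto)

lemma cube_morphism_face:
  assumes "i \<in> {1..Suc n}" "a = 0 \<or> a = 1"
  shows "cube_morphism n (Suc n) (face (Suc n) i a)"
proof (rule cube_morphismI[where \<gamma> = "\<lambda>l. if l < i then l else if l = i then 0 else l - 1"])
  fix l assume "l \<in> {1..Suc n}"
  then show "((if l < i then l else if l = i then 0 else l - 1) = 0 \<and> (\<exists>c. \<forall>v\<in>vertices n. face (Suc n) i a v l = c)) \<or>
           ((if l < i then l else if l = i then 0 else l - 1) \<in> {1..n} \<and>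
             ((\<forall>v\<in>vertices n. face (Suc n) i a v l = v (if l < i then l else if l = i then 0 else l - 1)) \<or>
              (\<forall>v\<in>vertices n. face (Suc n) i a v l = 1 - v (if l < i then l else if l = i then 0 else l - 1))))"
    using assms by (auto simp: face_def)
qed (use face_in[OF assms] in auto)

definition reflect :: "nat \<Rightarrow> nat set \<Rightarrow> (nat \<Rightarrow> nat) \<Rightarrow> nat \<Rightarrow> nat" where
  "reflect n M v = (\<lambda>l\<in>{1..n}. if l \<in> M then 1 - v l else v l)"

lemma reflect_in: "v \<in> vertices n \<Longrightarrow> reflect n M v \<in> vertices n"
  unfolding reflect_def by (rule restrict_in_vertices) (auto dest: vertices_01)

lemma cube_morphism_reflect: "cube_morphism n n (reflect n M)"
  by (rule cube_morphismI[where \<gamma> = id]) (auto simp: reflect_in, auto simp: reflect_def)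

lemma cube_morphism_zero: "j \<in> {1..n} \<Longrightarrow> cube_morphism n n (\<lambda>v. v(j := 0))"
  by (rule cube_morphismI[where \<gamma> = "\<lambda>l. if l = j then 0 else l"]) (auto simp: vertex_upd)

text \<open>The antidiagonal of the square spanned by the doubled coordinates runs from (1,0) to
  (0,1). It avoids the corner (1,1), where a completed cube is not controlled.\<close>

definition unfold_coord :: "nat \<Rightarrow> nat \<Rightarrow> (nat \<Rightarrow> nat) \<Rightarrow> nat \<Rightarrow> nat" where
  "unfold_coord n j v =
     (\<lambda>l\<in>{1..Suc n}. if l < j then v l else if l = j then 1 - v j else v (l - 1))"

lemma unfold_coord_in:
  assumes "j \<in> {1..n}" "v \<in> vertices n"
  shows "unfold_coord n j v \<in> vertices (Suc n)"
  unfolding unfold_coord_def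
proof (rule restrict_in_vertices)
  fix l assume *: "l \<in> {1..Suc n}"
  show "(if l < j then v l else if l = j then 1 - v j else v (l - 1)) = 0 \<or>
        (if l < j then v l else if l = j then 1 - v j else v (l - 1)) = 1"
  proof (cases l j rule: linorder_cases)
    case greater
    then have "l - 1 \<in> {1..n}" using * assms by auto
    then show ?thesis using vertices_01[OF assms(2)] greater by simp
  qed (use * assms vertices_01[OF assms(2), of l] vertices_01[OF assms(2), of j] in auto)
qed

lemma cube_morphism_unfold_coord:
  assumes "j \<in> {1..n}"
  shows "cube_morphism n (Suc n) (unfold_coord n j)"
proof (rule cube_morphismI[where \<gamma> = "\<lambda>l. if l \<le> j then l else l - 1"])
  fix l assume "l \<in> {1..Suc n}"
  then show "((if l \<le> j then l else l - 1) = 0 \<and> (\<exists>c. \<forall>v\<in>vertices n. unfold_coord n j v l = c)) \<or>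
           ((if l \<le> j then l else l - 1) \<in> {1..n} \<and>
             ((\<forall>v\<in>vertices n. unfold_coord n j v l = v (if l \<le> j then l else l - 1)) \<or>
              (\<forall>v\<in>vertices n. unfold_coord n j v l = 1 - v (if l \<le> j then l else l - 1))))"
    using assms by (auto simp: unfold_coord_def)
qed (use assms in \<open>auto simp: unfold_coord_in\<close>)

section \<open>Gluing cubes of a groupspace\<close>

context groupspace
begin

lemma cube_in: "c \<in> C n \<Longrightarrow> c \<in> vertices n \<rightarrow>\<^sub>E X"
  using cubes_subset by blast

lemma cube_apply_in: "c \<in> C n \<Longrightarrow> v \<in> vertices n \<Longrightarrow> c v \<in> X"
  using cube_in by blast

text \<open>Any map on a smaller cube is a face of a map one dimension higher that ignores the extra
  coordinate. All maps there are cubes, and faces of cubes are cubes.\<close>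

lemma full_le:
  assumes "m \<le> k" and k: "C k = vertices k \<rightarrow>\<^sub>E X"
  shows "C m = vertices m \<rightarrow>\<^sub>E X"
  using assms(1)
proof (induction rule: inc_induct)
  case base
  then show ?case by (rule k)
next
  case (step n)
  have "f \<in> C n" if f: "f \<in> vertices n \<rightarrow>\<^sub>E X" for f
  proof -
    let ?g = "\<lambda>w\<in>vertices (Suc n). f (drop_coord n 1 w)"
    have "?g \<in> C (Suc n)" using f step(3) drop_coord_in by auto
    then have "compose (vertices n) ?g (face (Suc n) 1 0) \<in> C n"
      by (rule presheaf) (simp add: cube_morphism_face)
    also have "compose (vertices n) ?g (face (Suc n) 1 0) = f"
    proof
      fix v
      show "compose (vertices n) ?g (face (Suc n) 1 0) v = f v"
        using f drop_coord_face[of 1 n v 0] face_in[of 1 n 0 v]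
        by (cases "v \<in> vertices n") (auto simp: compose_def PiE_iff extensional_def)
    qed
    finally show ?thesis .
  qed
  then show ?case using cube_in by blast
qed

text \<open>Completion in dimension 0: the punctured 0-cube is empty, so the empty function is a
  corner, and its completion takes a value in \<open>X\<close>.\<close>

lemma X_nonempty: "X \<noteq> {}"
proof -
  have "punctured_vertices 0 = {}"
    by (auto simp: punctured_vertices_def vertices_def all_one_def)
  then have "corner X C 0 (\<lambda>_. undefined)" by (simp add: corner_def)
  then obtain \<phi> where "\<phi> \<in> C 0" using completion unfolding completes_def by blast
  then show ?thesis using cube_apply_in[OF _ all_one_in] by blast
qed

end

section \<open>Completion and gluing in dimension \<open>k + 1\<close>\<close>

locale ergodic_step_groupspace = groupspace X C for X :: "'a set" and C +
  fixes k :: nat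
  assumes step: "k_step k X C" and erg: "k_ergodic k X C"
begin

abbreviation N :: nat where "N \<equiv> Suc k"

lemma full: "m \<le> k \<Longrightarrow> C m = vertices m \<rightarrow>\<^sub>E X"
  using full_le erg unfolding k_ergodic_def by blast

text \<open>The faces that a corner has to have as cubes are of dimension \<open>k\<close>, where
  every map is a cube.\<close>

lemma corner_N:
  assumes f: "f \<in> punctured_vertices N \<rightarrow>\<^sub>E X"
  shows "corner X C N f"
  unfolding corner_def
proof (intro conjI ballI f)
  fix i assume i: "i \<in> {1..N}"
  have "face N i 0 v \<in> punctured_vertices N" if "v \<in> vertices k" for v
  proof -
    have "all_one N i = 1" using i by (simp add: all_one_def)
    then show ?thesis
      using face_in[OF i _ that, of 0] face_at[OF i, of 0 v] by (auto simp: punctured_vertices_def)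
  qed
  then show "compose (vertices (N - 1)) f (face N i 0) \<in> C (N - 1)"
    using f full[of k] by (auto simp: compose_def)
qed

lemma complete_top:
  assumes "\<And>v. v \<in> vertices N \<Longrightarrow> f v \<in> X"
  shows "\<exists>!x. x \<in> X \<and> (\<lambda>v\<in>vertices N. (f(all_one N := x)) v) \<in> C N"
proof -
  let ?f = "restrict f (punctured_vertices N)"
  have "?f \<in> punctured_vertices N \<rightarrow>\<^sub>E X"
    using assms by (auto simp: punctured_vertices_def)
  then have ex1: "\<exists>!\<phi>. completes C N ?f \<phi>"
    using step corner_N unfolding k_step_def by (simp add: corner_N)
  then obtain \<phi> where \<phi>: "completes C N ?f \<phi>" by blast
  have eq: "(\<lambda>v\<in>vertices N. (f(all_one N := \<phi> (all_one N))) v) = \<phi>"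
  proof
    fix v
    have "\<phi> v = f v" if "v \<in> vertices N" "v \<noteq> all_one N"
    proof -
      have "v \<in> punctured_vertices N" using that by (simp add: punctured_vertices_def)
      then show ?thesis using \<phi> unfolding completes_def by (metis restrict_apply')
    qed
    moreover have "\<phi> v = undefined" if "v \<notin> vertices N"
      using \<phi> cube_in that unfolding completes_def by (meson PiE_arb)
    ultimately show "(\<lambda>v\<in>vertices N. (f(all_one N := \<phi> (all_one N))) v) v = \<phi> v"
      by auto
  qed
  show ?thesis
  proof (rule ex1I[of _ "\<phi> (all_one N)"])
    show "\<phi> (all_one N) \<in> X \<and> (\<lambda>v\<in>vertices N. (f(all_one N := \<phi> (all_one N))) v) \<in> C N"
      unfolding eq using \<phi> cube_apply_in all_one_in unfolding completes_def by blast
  next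
    fix x assume x: "x \<in> X \<and> (\<lambda>v\<in>vertices N. (f(all_one N := x)) v) \<in> C N"
    have "restrict (\<lambda>v\<in>vertices N. (f(all_one N := x)) v) (punctured_vertices N) = ?f"
      by (auto simp: punctured_vertices_def fun_eq_iff)
    then have "completes C N ?f (\<lambda>v\<in>vertices N. (f(all_one N := x)) v)"
      using x by (simp add: completes_def)
    with ex1 \<phi> have "(\<lambda>v\<in>vertices N. (f(all_one N := x)) v) = \<phi>" by blast
    then show "x = \<phi> (all_one N)" using all_one_in[of N] by (metis fun_upd_same restrict_apply')
  qed
qed

text \<open>The values of \<open>F\<close> at the vertices whose only zero lies outside \<open>J\<close> are corrected so that all faces
  become cubes; these vertices lie on no face in a direction from \<open>J\<close>.\<close>

lemma extend_cube:
  assumes F: "\<And>w. w \<in> vertices (Suc N) \<Longrightarrow> F w \<in> X"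
    and J: "\<And>l. l \<in> J \<Longrightarrow> l \<in> {1..Suc N} \<Longrightarrow> compose (vertices N) F (face (Suc N) l 0) \<in> C N"
  obtains \<phi> where "\<phi> \<in> C (Suc N)"
    "\<And>w l. \<lbrakk>w \<in> vertices (Suc N); l \<in> J; l \<in> {1..Suc N}; w l = 0\<rbrakk> \<Longrightarrow> \<phi> w = F w"
proof -
  let ?o = "all_one (Suc N)"
  have one: "?o l = 1" if "l \<in> {1..Suc N}" for l using that by (simp add: all_one_def)
  have "\<exists>x. x \<in> X \<and> (\<lambda>v\<in>vertices N. ((\<lambda>v. F (face (Suc N) l 0 v))(all_one N := x)) v) \<in> C N"
    if l: "l \<in> {1..Suc N}" for l
    using complete_top[of "\<lambda>v. F (face (Suc N) l 0 v)"] F face_in[OF l] by blast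
  then obtain x where x: "\<And>l. l \<in> {1..Suc N} \<Longrightarrow> x l \<in> X"
    "\<And>l. l \<in> {1..Suc N} \<Longrightarrow>
        (\<lambda>v\<in>vertices N. ((\<lambda>v. F (face (Suc N) l 0 v))(all_one N := x l)) v) \<in> C N"
    by metis
  define pos where "pos w = (THE l. l \<in> {1..Suc N} \<and> w l = (0::nat))" for w
  define exc where "exc w \<longleftrightarrow> (\<exists>l\<in>{1..Suc N} - J. w = ?o(l := 0))" for w
  define G where "G w = (if exc w then x (pos w) else F w)" for w
  have exc_zero: "exc w \<Longrightarrow> l \<in> {1..Suc N} \<Longrightarrow> w l = 0 \<Longrightarrow> w = ?o(l := 0) \<and> l \<notin> J" for w l
    unfolding exc_def using one by (metis DiffE fun_upd_other zero_neq_one)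
  have pos: "pos (?o(l := 0)) = l" if "l \<in> {1..Suc N}" for l
    unfolding pos_def using that one by (intro the_equality) (auto split: if_splits)
  have G_in: "G w \<in> X" if "w \<in> vertices (Suc N)" for w
    using F[OF that] x(1) pos unfolding G_def exc_def by auto
  \<comment> \<open>A face in a direction \<open>l\<close> from \<open>J\<close> meets no
    exceptional vertex. Any other face meets exactly one, namely its own top vertex, where
    \<open>x l\<close> is the value that makes the face a cube.\<close>
  have face_G: "compose (vertices N) G (face (Suc N) l 0) \<in> C N" if l: "l \<in> {1..Suc N}" for l
  proof (cases "l \<in> J")
    case True
    have "\<not> exc (face (Suc N) l 0 v)" for v
      using exc_zero[OF _ l, of "face (Suc N) l 0 v"] face_at[OF l, of 0 v] True by blast
    then have "compose (vertices N) G (face (Suc N) l 0) = compose (vertices N) F (face (Suc N) l 0)"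
      by (simp add: compose_def G_def)
    then show ?thesis using J[OF True l] by simp
  next
    case False
    have "compose (vertices N) G (face (Suc N) l 0)
      = (\<lambda>v\<in>vertices N. ((\<lambda>v. F (face (Suc N) l 0 v))(all_one N := x l)) v)"
    proof
      fix v
      show "compose (vertices N) G (face (Suc N) l 0) v
        = (\<lambda>v\<in>vertices N. ((\<lambda>v. F (face (Suc N) l 0 v))(all_one N := x l)) v) v"
      proof (cases "v \<in> vertices N \<and> v \<noteq> all_one N")
        case True
        then have "face (Suc N) l 0 v \<noteq> face (Suc N) l 0 (all_one N)"
          using inj_on_face[OF l, of 0] all_one_in[of N] by (auto dest: inj_onD)
        then have "\<not> exc (face (Suc N) l 0 v)"
          using exc_zero[OF _ l, of "face (Suc N) l 0 v"] face_at[OF l] face_all_one[OF l] by auto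
        then show ?thesis using True by (simp add: compose_def G_def)
      next
        case v: False
        have "exc (?o(l := 0))" unfolding exc_def using l False by blast
        then show ?thesis
          using v pos[OF l] face_all_one[OF l] by (auto simp: compose_def G_def)
      qed
    qed
    then show ?thesis using x(2)[OF l] by simp
  qed
  have not_one: "face (Suc N) l 0 v \<noteq> ?o" if "l \<in> {1..Suc N}" for l v
    using face_at[OF that, of 0 v] one[OF that] by auto
  let ?f = "restrict G (punctured_vertices (Suc N))"
  have "corner X C (Suc N) ?f"
    unfolding corner_def
  proof (intro conjI ballI)
    show "?f \<in> punctured_vertices (Suc N) \<rightarrow>\<^sub>E X"
      using G_in by (auto simp: punctured_vertices_def)
    fix l assume l: "l \<in> {1..Suc N}"
    have "compose (vertices N) ?f (face (Suc N) l 0) = compose (vertices N) G (face (Suc N) l 0)"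
      using face_in[OF l] not_one[OF l] by (auto simp: compose_def punctured_vertices_def fun_eq_iff)
    then show "compose (vertices (Suc N - 1)) ?f (face (Suc N) l 0) \<in> C (Suc N - 1)"
      using face_G[OF l] by simp
  qed
  then obtain \<phi> where \<phi>: "completes C (Suc N) ?f \<phi>" using completion by blast
  show ?thesis
  proof
    show "\<phi> \<in> C (Suc N)" using \<phi> by (simp add: completes_def)
    fix w l assume w: "w \<in> vertices (Suc N)" "l \<in> J" "l \<in> {1..Suc N}" "w l = 0"
    then have "w \<noteq> ?o" using one by auto
    with w(1) have "w \<in> punctured_vertices (Suc N)" by (simp add: punctured_vertices_def)
    then have "\<phi> w = G w" using \<phi> unfolding completes_def by (metis restrict_apply')
    also have "\<dots> = F w" using exc_zero[of w l] w by (auto simp: G_def)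
    finally show "\<phi> w = F w" .
  qed
qed

text \<open>The cubes \<open>c\<close> (reflected) and \<open>d\<close> are placed on two adjacent faces of a cube with coordinate \<open>j\<close>
  doubled. The glued cube is the antidiagonal \<open>v\<^sub>j \<mapsto> (1 - v\<^sub>j, v\<^sub>j)\<close>; the monotonicity
  condition on morphisms is why the doubled coordinates have to be adjacent.\<close>

lemma cube_glue:
  assumes c: "c \<in> C N" and d: "d \<in> C N" and j: "j \<in> {1..N}"
    and cd: "\<And>v. v \<in> vertices N \<Longrightarrow> c (v(j := 1)) = d (v(j := 0))"
  shows "(\<lambda>v\<in>vertices N. if v j = 0 then c v else d v) \<in> C N"
proof -
  obtain e where e: "e \<in> X" using X_nonempty by blast
  \<comment> \<open>The face \<open>w j = 0\<close> carries \<open>d\<close> along coordinate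
    \<open>Suc j\<close>. The face \<open>w (Suc j) = 0\<close> carries \<open>c\<close> with
    direction \<open>j\<close> reversed, so \<open>c\<close> is read at 0 where \<open>w j\<close>
    is 1. On the overlap only \<open>d\<close> is read, which is consistent by \<open>cd\<close>.
    Elsewhere \<open>e\<close> is a mere filler.\<close>
  define F where "F w = (if w j = 0 then d (drop_coord N j w)
      else if w (Suc j) = (0::nat) then c ((drop_coord N (Suc j) w)(j := 0)) else e)" for w
  have j': "j \<in> {1..Suc N}" "Suc j \<in> {1..Suc N}" using j by auto
  have F_in: "F w \<in> X" if "w \<in> vertices (Suc N)" for w
    unfolding F_def using e cube_apply_in c d drop_coord_in that vertex_upd j by auto
  have 1: "compose (vertices N) F (face (Suc N) j 0) = d"
  proof
    fix v
    show "compose (vertices N) F (face (Suc N) j 0) v = d v"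
      using drop_coord_face[OF j'(1), of v 0] face_at[OF j'(1), of 0 v] cube_in[OF d]
      by (cases "v \<in> vertices N") (auto simp: compose_def F_def PiE_iff extensional_def)
  qed
  have 2: "compose (vertices N) F (face (Suc N) (Suc j) 0) = compose (vertices N) c (reflect N {j})"
  proof
    fix v
    show "compose (vertices N) F (face (Suc N) (Suc j) 0) v = compose (vertices N) c (reflect N {j}) v"
    proof (cases "v \<in> vertices N")
      case v: True
      let ?w = "face (Suc N) (Suc j) 0 v"
      have wj: "?w j = v j" "?w (Suc j) = 0" using j by (auto simp: face_def)
      have r: "reflect N {j} v = v(j := 1 - v j)"
        by (rule vertices_eqI[OF reflect_in[OF v] vertex_upd[OF v j]])
          (use vertices_01[OF v j] in \<open>auto simp: reflect_def\<close>)
      have drop: "drop_coord N j ?w = v(j := 0)"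
        by (rule vertices_eqI[OF drop_coord_in[OF face_in[OF j'(2) _ v]] vertex_upd[OF v j]])
          (use j in \<open>auto simp: drop_coord_def face_def\<close>)
      show ?thesis
      proof (cases "v j = 0")
        case True
        then have "F ?w = c (v(j := 1))" using wj drop cd[OF v] by (simp add: F_def)
        then show ?thesis using v r True by (simp add: compose_def)
      next
        case False
        then have "v j = 1" using vertices_01[OF v j] by simp
        then show ?thesis
          using v r wj drop_coord_face[OF j'(2) v, of 0] by (simp add: compose_def F_def)
      qed
    qed (simp add: compose_def)
  qed
  have "compose (vertices N) F (face (Suc N) l 0) \<in> C N" if "l \<in> {j, Suc j}" for l
    using that 1 2 d presheaf[OF c cube_morphism_reflect] by auto
  then obtain \<phi> where \<phi>: "\<phi> \<in> C (Suc N)"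
    "\<And>w l. \<lbrakk>w \<in> vertices (Suc N); l \<in> {j, Suc j}; l \<in> {1..Suc N}; w l = 0\<rbrakk> \<Longrightarrow> \<phi> w = F w"
    using extend_cube[of F "{j, Suc j}"] F_in by blast
  have "compose (vertices N) \<phi> (unfold_coord N j) \<in> C N"
    using presheaf[OF \<phi>(1) cube_morphism_unfold_coord[OF j]] .
  also have "compose (vertices N) \<phi> (unfold_coord N j) = (\<lambda>v\<in>vertices N. if v j = 0 then c v else d v)"
  proof
    fix v
    show "compose (vertices N) \<phi> (unfold_coord N j) v = (\<lambda>v\<in>vertices N. if v j = 0 then c v else d v) v"
    proof (cases "v \<in> vertices N")
      case v: True
      let ?w = "unfold_coord N j v"
      have w: "?w \<in> vertices (Suc N)" by (rule unfold_coord_in[OF j v])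
      have wj: "?w j = 1 - v j" "?w (Suc j) = v j" using j by (auto simp: unfold_coord_def)
      show ?thesis
      proof (cases "v j = 0")
        case True
        have "(drop_coord N (Suc j) ?w)(j := 0) = v"
          by (rule vertices_eqI[OF vertex_upd[OF drop_coord_in[OF w] j] v])
            (use j True in \<open>auto simp: drop_coord_def unfold_coord_def\<close>)
        then have "F ?w = c v" using wj True by (simp add: F_def)
        then show ?thesis using \<phi>(2)[OF w _ j'(2)] wj True v by (simp add: compose_def)
      next
        case False
        then have vj: "v j = 1" using vertices_01[OF v j] by simp
        have "drop_coord N j ?w = v"
          by (rule vertices_eqI[OF drop_coord_in[OF w] v])
            (use j in \<open>auto simp: drop_coord_def unfold_coord_def\<close>)
        then have "F ?w = d v" using wj vj by (simp add: F_def)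
        then show ?thesis using \<phi>(2)[OF w _ j'(1)] wj vj v by (simp add: compose_def)
      qed
    qed (simp add: compose_def)
  qed
  finally show ?thesis .
qed

end

section \<open>The abelian group of a k-ergodic k-step groupspace\<close>

definition supp :: "nat \<Rightarrow> (nat \<Rightarrow> nat) \<Rightarrow> nat set" where
  "supp n v = {l \<in> {1..n}. v l = 1}"

definition vec :: "nat \<Rightarrow> nat set \<Rightarrow> nat \<Rightarrow> nat" where
  "vec n S = (\<lambda>l\<in>{1..n}. if l \<in> S then 1 else 0)"

lemma supp_subset: "supp n v \<subseteq> {1..n}"
  by (auto simp: supp_def)

lemma vec_in: "vec n S \<in> vertices n"
  unfolding vec_def by (rule restrict_in_vertices) simp

lemma supp_vec: "S \<subseteq> {1..n} \<Longrightarrow> supp n (vec n S) = S"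
  by (auto simp: supp_def vec_def)

lemma vec_supp: "v \<in> vertices n \<Longrightarrow> vec n (supp n v) = v"
  by (rule vertices_eqI[OF vec_in]) (auto simp: supp_def vec_def dest: vertices_01)

lemma supp_all_one: "supp n (all_one n) = {1..n}"
  by (auto simp: supp_def all_one_def)

lemma supp_eq_full: "v \<in> vertices n \<Longrightarrow> supp n v = {1..n} \<longleftrightarrow> v = all_one n"
  by (metis vec_supp supp_all_one all_one_in)

lemma supp_upd: "j \<in> {1..n} \<Longrightarrow> supp n (v(j := 1)) = insert j (supp n v)"
  "supp n (v(j := 0)) = supp n v - {j}"
  by (auto simp: supp_def)

lemma supp_reflect:
  assumes "v \<in> vertices n" "M \<subseteq> {1..n}"
  shows "supp n (reflect n M v) = (supp n v - M) \<union> (M - supp n v)"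
proof (rule Set.set_eqI)
  fix l
  show "l \<in> supp n (reflect n M v) \<longleftrightarrow> l \<in> (supp n v - M) \<union> (M - supp n v)"
  proof (cases "l \<in> {1..n}")
    case True
    then show ?thesis using vertices_01[OF assms(1) True] by (auto simp: supp_def reflect_def)
  qed (use assms(2) in \<open>auto simp: supp_def\<close>)
qed

lemma vec_image: "vec n ` Pow {1..n} = vertices n"
proof (intro equalityI subsetI)
  fix v assume "v \<in> vertices n"
  then show "v \<in> vec n ` Pow {1..n}" using vec_supp[of v n] supp_subset by (metis PowI imageI)
qed (use vec_in in auto)

lemma inj_on_vec: "inj_on (vec n) (Pow {1..n})"
  by (metis PowD inj_on_inverseI supp_vec)

lemma height_vec: "S \<subseteq> {1..n} \<Longrightarrow> height n (vec n S) = card S"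
  by (simp add: height_def vec_def sum.If_cases Int_absorb1)

section \<open>Alternating sums over lower sets and their behaviour on faces\<close>

definition below :: "nat \<Rightarrow> (nat \<Rightarrow> nat) \<Rightarrow> (nat \<Rightarrow> nat) set" where
  "below n v = {u \<in> vertices n. \<forall>i\<in>{1..n}. u i \<le> v i}"

definition alt :: "('a, 'b) monoid_scheme \<Rightarrow> nat \<Rightarrow> ((nat \<Rightarrow> nat) \<Rightarrow> 'a) \<Rightarrow> (nat \<Rightarrow> nat) set \<Rightarrow> 'a" where
  "alt A n f S = finprod A (\<lambda>u. f u [^]\<^bsub>A\<^esub> ((- 1) ^ height n u :: int)) S"

lemma abelian_cubes_alt:
  "abelian_cubes k A n = {f \<in> vertices n \<rightarrow>\<^sub>E carrier A.
     \<forall>v\<in>vertices n. k + 1 \<le> height n v \<longrightarrow> alt A n f (below n v) = \<one>\<^bsub>A\<^esub>}"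
  by (simp add: abelian_cubes_def alt_def below_def)

lemma below_all_one: "below n (all_one n) = vertices n"
proof -
  have "u i \<le> all_one n i" if "u \<in> vertices n" "i \<in> {1..n}" for u i
    using vertices_01[OF that] that(2) by (auto simp: all_one_def)
  then show ?thesis by (auto simp: below_def)
qed

text \<open>Everything below a vertex with a zero coordinate stays in the corresponding face. This
  is how the conditions defining \<open>abelian_cubes\<close> pass between dimensions.\<close>

lemma below_face:
  assumes i: "i \<in> {1..Suc n}" and v: "v \<in> vertices n"
  shows "below (Suc n) (face (Suc n) i 0 v) = face (Suc n) i 0 ` below n v"
proof (intro equalityI subsetI)
  fix w assume "w \<in> below (Suc n) (face (Suc n) i 0 v)"
  then have w: "w \<in> vertices (Suc n)" "\<And>l. l \<in> {1..Suc n} \<Longrightarrow> w l \<le> face (Suc n) i 0 v l"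
    by (auto simp: below_def)
  have "w i = 0" using w(2)[OF i] face_at[OF i, of 0 v] by simp
  then have "w = face (Suc n) i 0 (drop_coord n i w)" using face_drop_coord[OF i w(1)] by simp
  moreover have "drop_coord n i w l \<le> v l" if l: "l \<in> {1..n}" for l
    using w(2)[of l] w(2)[of "Suc l"] l i by (auto simp: drop_coord_def face_def)
  then have "drop_coord n i w \<in> below n v"
    using drop_coord_in[OF w(1)] by (simp add: below_def)
  ultimately show "w \<in> face (Suc n) i 0 ` below n v" by blast
next
  fix w assume "w \<in> face (Suc n) i 0 ` below n v"
  then obtain u where u: "w = face (Suc n) i 0 u" "u \<in> vertices n" "\<And>l. l \<in> {1..n} \<Longrightarrow> u l \<le> v l"
    by (auto simp: below_def)
  have "w l \<le> face (Suc n) i 0 v l" if l: "l \<in> {1..Suc n}" for l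
  proof (cases l i rule: linorder_cases)
    case greater
    then have "l - 1 \<in> {1..n}" using l i by auto
    then show ?thesis using u(3)[of "l - 1"] l i greater by (simp add: u(1) face_def)
  qed (use l i u(3)[of l] in \<open>auto simp: u(1) face_def\<close>)
  then show "w \<in> below (Suc n) (face (Suc n) i 0 v)"
    using face_in[OF i _ u(2)] by (simp add: below_def u(1))
qed

lemma (in comm_group) finprod_int_pow:
  assumes "g \<in> S \<rightarrow> carrier G"
  shows "finprod G (\<lambda>x. g x [^] (z::int)) S = finprod G g S [^] z"
  using assms
proof (induction S rule: infinite_finite_induct)
  case (insert x S)
  then have "g x \<in> carrier G" "g \<in> S \<rightarrow> carrier G" by auto
  then show ?case using insert
    by (simp add: Pi_def int_pow_mult_distrib m_comm)
qed (simp_all add: int_pow_one)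

text \<open>The face at \<open>a = 1\<close> raises every height by one and so inverts the product;
  the exponent \<open>(-1) ^ a\<close> covers both faces at once.\<close>

lemma (in comm_group) alt_face:
  assumes i: "i \<in> {1..Suc n}" and a: "a = 0 \<or> a = 1" and S: "S \<subseteq> vertices n"
    and f: "f \<in> vertices (Suc n) \<rightarrow> carrier G"
  shows "alt G (Suc n) f (face (Suc n) i a ` S)
    = alt G n (compose (vertices n) f (face (Suc n) i a)) S [^] ((-1) ^ a :: int)"
proof -
  have fin: "f (face (Suc n) i a u) \<in> carrier G" if "u \<in> S" for u
    using f face_in[OF i a] S that by blast
  have "alt G (Suc n) f (face (Suc n) i a ` S)
    = finprod G (\<lambda>u. f (face (Suc n) i a u) [^] ((-1) ^ height (Suc n) (face (Suc n) i a u) :: int)) S"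
    unfolding alt_def
    by (rule finprod_reindex) (use fin inj_on_face[OF i, of a] S in \<open>auto intro: inj_on_subset\<close>)
  also have "\<dots> = finprod G (\<lambda>u. (compose (vertices n) f (face (Suc n) i a) u
       [^] ((-1) ^ height n u :: int)) [^] ((-1) ^ a :: int)) S"
  proof (rule finprod_cong')
    fix u assume u: "u \<in> S"
    show "f (face (Suc n) i a u) [^] ((-1) ^ height (Suc n) (face (Suc n) i a u) :: int)
      = (compose (vertices n) f (face (Suc n) i a) u [^] ((-1) ^ height n u :: int)) [^] ((-1) ^ a :: int)"
      using u S fin[OF u] by (simp add: height_face[OF i] compose_def int_pow_pow power_add subset_iff)
  qed (use fin S in \<open>auto simp: compose_def\<close>)
  also have "\<dots> = alt G n (compose (vertices n) f (face (Suc n) i a)) S [^] ((-1) ^ a :: int)"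
    unfolding alt_def by (rule finprod_int_pow) (use fin S in \<open>auto simp: compose_def\<close>)
  finally show ?thesis .
qed

section \<open>Cubes of dimension \<open>k + 1\<close> as functions of subsets\<close>

context ergodic_step_groupspace
begin

text \<open>Values at sets that are not inside \<open>{1..N}\<close> are discarded by
  \<open>supp\<close>, so functions on all sets can be used without extensionality
  conditions.\<close>

definition cub :: "(nat set \<Rightarrow> 'a) \<Rightarrow> bool" where
  "cub f \<longleftrightarrow> (\<lambda>v\<in>vertices N. f (supp N v)) \<in> C N"

lemma cub_cong:
  assumes "\<And>S. S \<subseteq> {1..N} \<Longrightarrow> f S = g S"
  shows "cub f \<longleftrightarrow> cub g"
proof -
  have "(\<lambda>v\<in>vertices N. f (supp N v)) = (\<lambda>v\<in>vertices N. g (supp N v))"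
    using assms[OF supp_subset] by (intro restrict_ext)
  then show ?thesis by (simp add: cub_def)
qed

lemma cub_morphism:
  assumes "cub f" "cube_morphism N N \<phi>"
  shows "(\<lambda>v\<in>vertices N. f (supp N (\<phi> v))) \<in> C N"
proof -
  have "\<phi> v \<in> vertices N" if "v \<in> vertices N" for v
    using assms(2) that by (auto simp: cube_morphism_def)
  then have "compose (vertices N) (\<lambda>v\<in>vertices N. f (supp N v)) \<phi> = (\<lambda>v\<in>vertices N. f (supp N (\<phi> v)))"
    by (auto simp: compose_def fun_eq_iff)
  then show ?thesis using presheaf[OF assms(1)[unfolded cub_def] assms(2)] by simp
qed

lemma cub_reflect:
  assumes "cub f" "M \<subseteq> {1..N}"
  shows "cub (\<lambda>S. f ((S - M) \<union> (M - S)))"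
proof -
  have "(\<lambda>v\<in>vertices N. f (supp N (reflect N M v)))
      = (\<lambda>v\<in>vertices N. f ((supp N v - M) \<union> (M - supp N v)))"
    using supp_reflect[OF _ assms(2)] by (intro restrict_ext) simp
  then show ?thesis using cub_morphism[OF assms(1) cube_morphism_reflect, of M] by (simp add: cub_def)
qed

lemma cub_drop:
  assumes "cub f" "j \<in> {1..N}"
  shows "cub (\<lambda>S. f (S - {j}))"
  using cub_morphism[OF assms(1) cube_morphism_zero[OF assms(2)]] by (simp add: cub_def supp_upd)

lemma cub_complete_top:
  assumes f: "f \<in> Pow {1..N} \<rightarrow> X"
  shows "\<exists>!x. x \<in> X \<and> cub (f({1..N} := x))"
proof -
  have "(\<lambda>v\<in>vertices N. ((\<lambda>v. f (supp N v))(all_one N := x)) v)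
    = (\<lambda>v\<in>vertices N. (f({1..N} := x)) (supp N v))" for x
    using supp_eq_full by (intro restrict_ext) simp
  moreover have "\<exists>!x. x \<in> X \<and> (\<lambda>v\<in>vertices N. ((\<lambda>v. f (supp N v))(all_one N := x)) v) \<in> C N"
    by (rule complete_top) (use f supp_subset in blast)
  ultimately show ?thesis by (simp add: cub_def)
qed

text \<open>Reflecting in the complement \<open>M\<close> of \<open>V\<close> exchanges
  \<open>V\<close> with the top vertex and preserves cubes in both directions, so unique completion
  moves from the top vertex to \<open>V\<close>.\<close>

lemma cub_complete:
  assumes f: "f \<in> Pow {1..N} \<rightarrow> X" and V: "V \<subseteq> {1..N}"
  shows "\<exists>!x. x \<in> X \<and> cub (f(V := x))"
proof -
  define M where "M = {1..N} - V"
  have M: "M \<subseteq> {1..N}" by (auto simp: M_def)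
  define r where "r S = (S - M) \<union> (M - S)" for S
  have r: "r (r S) = S" "S \<subseteq> {1..N} \<Longrightarrow> r S \<subseteq> {1..N}" for S using M by (auto simp: r_def)
  have rV: "r V = {1..N}" using V by (auto simp: r_def M_def)
  have rr: "r S = V \<longleftrightarrow> S = {1..N}" "r S = {1..N} \<longleftrightarrow> S = V" for S using r(1) rV by metis+
  define g where "g S = f (r S)" for S
  have "cub (f(V := x)) \<longleftrightarrow> cub (g({1..N} := x))" for x
  proof
    assume "cub (f(V := x))"
    from cub_reflect[OF this M] have "cub (\<lambda>S. (f(V := x)) (r S))" by (simp add: r_def)
    also have "(\<lambda>S. (f(V := x)) (r S)) = g({1..N} := x)" using rr by (auto simp: g_def)
    finally show "cub (g({1..N} := x))" .
  next
    assume "cub (g({1..N} := x))"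
    from cub_reflect[OF this M] have "cub (\<lambda>S. (g({1..N} := x)) (r S))" by (simp add: r_def)
    also have "(\<lambda>S. (g({1..N} := x)) (r S)) = f(V := x)" using rr r(1) by (auto simp: g_def)
    finally show "cub (f(V := x))" .
  qed
  moreover have "g \<in> Pow {1..N} \<rightarrow> X" using f r(2) unfolding g_def by blast
  ultimately show ?thesis using cub_complete_top by simp
qed

text \<open>Some change of \<open>f\<close> at the top vertex alone yields a cube. Setting
  coordinate \<open>j\<close> to zero never reads the top vertex, and by \<open>deg\<close> it turns
  the changed map back into \<open>f\<close>.\<close>

lemma cub_degenerate:
  assumes f: "f \<in> Pow {1..N} \<rightarrow> X" and j: "j \<in> {1..N}"
    and deg: "\<And>S. S \<subseteq> {1..N} \<Longrightarrow> f S = f (S - {j})"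
  shows "cub f"
proof -
  obtain x where "cub (f({1..N} := x))" using cub_complete_top[OF f] by blast
  from cub_drop[OF this j] have "cub (\<lambda>S. (f({1..N} := x)) (S - {j}))" .
  moreover have "(f({1..N} := x)) (S - {j}) = f S" if "S \<subseteq> {1..N}" for S
  proof -
    have "S - {j} \<noteq> {1..N}" using j by blast
    then show ?thesis using deg[OF that] by simp
  qed
  ultimately show ?thesis by (rule cub_cong[THEN iffD1, rotated])
qed

lemma cub_glue:
  assumes f: "cub f" and g: "cub g" and j: "j \<in> {1..N}"
    and fg: "\<And>S. S \<subseteq> {1..N} \<Longrightarrow> f (insert j S) = g (S - {j})"
  shows "cub (glue j f g)"
proof -
  let ?c = "\<lambda>v\<in>vertices N. f (supp N v)" and ?d = "\<lambda>v\<in>vertices N. g (supp N v)"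
  have "?c (v(j := 1)) = ?d (v(j := 0))" if "v \<in> vertices N" for v
    using vertex_upd[OF that j] fg[OF supp_subset] supp_upd j by simp
  then have "(\<lambda>v\<in>vertices N. if v j = 0 then ?c v else ?d v) \<in> C N"
    using cube_glue[OF f[unfolded cub_def] g[unfolded cub_def] j] by simp
  also have "(\<lambda>v\<in>vertices N. if v j = 0 then ?c v else ?d v) = (\<lambda>v\<in>vertices N. glue j f g (supp N v))"
  proof (rule restrict_ext)
    fix v assume v: "v \<in> vertices N"
    show "(if v j = 0 then ?c v else ?d v) = glue j f g (supp N v)"
      using vertices_01[OF v j] v j by (auto simp: glue_def supp_def)
  qed
  finally show ?thesis unfolding cub_def .
qed

text \<open>Splitting off the last direction leaves both faces indexed by subsets of
  \<open>{1..k}\<close> without renumbering.\<close>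

definition stack :: "(nat set \<Rightarrow> 'a) \<Rightarrow> (nat set \<Rightarrow> 'a) \<Rightarrow> nat set \<Rightarrow> 'a" where
  "stack f g S = (if N \<in> S then g (S - {N}) else f S)"

lemma subset_N: "S \<subseteq> {1..N} \<Longrightarrow> S - {N} \<subseteq> {1..k}"
  "S \<subseteq> {1..N} \<Longrightarrow> N \<notin> S \<Longrightarrow> S \<subseteq> {1..k}"
  by (auto simp: subset_iff le_Suc_eq)

lemma stack_in:
  assumes "f \<in> Pow {1..k} \<rightarrow> X" "g \<in> Pow {1..k} \<rightarrow> X"
  shows "stack f g \<in> Pow {1..N} \<rightarrow> X"
proof
  fix S assume "S \<in> Pow {1..N}"
  then show "stack f g S \<in> X"
    using assms subset_N[of S] unfolding stack_def by (simp add: Pi_def)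
qed

text \<open>Reflexivity is degeneracy in direction \<open>N\<close>, symmetry is reflection in
  \<open>N\<close>, transitivity is gluing along \<open>N\<close>. For the other axioms, a vertex
  \<open>V\<close> of the second face is \<open>insert N V\<close> in the whole cube, and operations
  in a direction \<open>j\<close> different from \<open>N\<close> act on both faces
  separately.\<close>

lemma cube_congruence_stack:
  assumes e: "e \<in> X"
  shows "cube_congruence {1..k} X e (\<lambda>f g. cub (stack f g))"
proof
  show "finite {1..k}" by simp
  show "e \<in> X" by (rule e)
next
  fix f g :: "nat set \<Rightarrow> 'a" assume f: "f \<in> Pow {1..k} \<rightarrow> X" and fg: "\<And>S. S \<subseteq> {1..k} \<Longrightarrow> f S = g S"
  have g: "g \<in> Pow {1..k} \<rightarrow> X" using f fg by (auto simp: Pi_def)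
  show "cub (stack f g)"
    by (rule cub_degenerate[OF stack_in[OF f g], of N]) (use fg subset_N in \<open>auto simp: stack_def\<close>)
next
  fix f g :: "nat set \<Rightarrow> 'a" assume "cub (stack f g)"
  from cub_reflect[OF this, of "{N}"] have "cub (\<lambda>S. stack f g ((S - {N}) \<union> ({N} - S)))" by simp
  also have "(\<lambda>S. stack f g ((S - {N}) \<union> ({N} - S))) = stack g f"
    by (intro ext) (auto simp: stack_def)
  finally show "cub (stack g f)" .
next
  fix f g h :: "nat set \<Rightarrow> 'a" assume "cub (stack f g)" "cub (stack g h)"
  then have "cub (glue N (stack f g) (stack g h))" by (rule cub_glue) (auto simp: stack_def)
  also have "glue N (stack f g) (stack g h) = stack f h" by (auto simp: glue_def stack_def)
  finally show "cub (stack f h)" .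
next
  fix f g :: "nat set \<Rightarrow> 'a" and V
  assume f: "f \<in> Pow {1..k} \<rightarrow> X" and g: "g \<in> Pow {1..k} \<rightarrow> X" and V: "V \<subseteq> {1..k}"
  have NV: "N \<notin> V" using V by auto
  have "stack f (g(V := x)) S = ((stack f g)(insert N V := x)) S" for x S
  proof -
    have "S - {N} = V \<longleftrightarrow> S = insert N V" if "N \<in> S" using that NV by auto
    then show ?thesis by (auto simp: stack_def)
  qed
  then have "stack f (g(V := x)) = (stack f g)(insert N V := x)" for x by blast
  moreover have "insert N V \<subseteq> {1..N}" using V by auto
  ultimately show "\<exists>!x. x \<in> X \<and> cub (stack f (g(V := x)))"
    using cub_complete[OF stack_in[OF f g]] by simp
next
  fix j and f f' g g' :: "nat set \<Rightarrow> 'a"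
  assume j: "j \<in> {1..k}" and ff: "cub (stack f f')" and gg: "cub (stack g g')"
    and fg: "\<And>S. S \<subseteq> {1..k} \<Longrightarrow> f (insert j S) = g (S - {j})"
    and fg': "\<And>S. S \<subseteq> {1..k} \<Longrightarrow> f' (insert j S) = g' (S - {j})"
  have jN: "j \<noteq> N" "j \<in> {1..N}" using j by auto
  have "cub (glue j (stack f f') (stack g g'))"
  proof (rule cub_glue[OF ff gg jN(2)])
    fix S assume S: "S \<subseteq> {1..N}"
    have "insert j S - {N} = insert j (S - {N})" "S - {j} - {N} = S - {N} - {j}" using jN(1) by auto
    then show "stack f f' (insert j S) = stack g g' (S - {j})"
      using fg[OF subset_N(2)[OF S]] fg'[OF subset_N(1)[OF S]] jN(1) by (simp add: stack_def)
  qed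
  also have "glue j (stack f f') (stack g g') = stack (glue j f g) (glue j f' g')"
    using jN(1) by (auto simp: glue_def stack_def)
  finally show "cub (stack (glue j f g) (glue j f' g'))" .
next
  fix j and f g :: "nat set \<Rightarrow> 'a"
  assume j: "j \<in> {1..k}" and f: "f \<in> Pow {1..k} \<rightarrow> X" and g: "g \<in> Pow {1..k} \<rightarrow> X"
    and df: "\<And>S. S \<subseteq> {1..k} \<Longrightarrow> f S = f (S - {j})"
    and dg: "\<And>S. S \<subseteq> {1..k} \<Longrightarrow> g S = g (S - {j})"
  have jN: "j \<noteq> N" "j \<in> {1..N}" using j by auto
  show "cub (stack f g)"
  proof (rule cub_degenerate[OF stack_in[OF f g] jN(2)])
    fix S assume S: "S \<subseteq> {1..N}"
    have "S - {j} - {N} = S - {N} - {j}" by auto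
    then show "stack f g S = stack f g (S - {j})"
      using df[OF subset_N(2)[OF S]] dg[OF subset_N(1)[OF S]] jN(1) by (simp add: stack_def)
  qed
qed

end

section \<open>The group law on \<open>X\<close> and the vanishing sum in dimension
  \<open>k + 1\<close>\<close>

context ergodic_step_groupspace
begin

text \<open>Opposite faces of a cube are related, hence have the same alternating sum, and the two
  sums enter the sum over the whole cube with opposite signs.\<close>

lemma exists_group:
  assumes k: "k \<ge> 2"
  obtains A :: "'a monoid" where "comm_group A" "carrier A = X"
    "\<And>c. c \<in> C N \<Longrightarrow> alt A N c (vertices N) = \<one>\<^bsub>A\<^esub>"
proof -
  obtain e where e: "e \<in> X" using X_nonempty by blast
  interpret cc: cube_congruence "{1..k}" X e "\<lambda>f g. cub (stack f g)"
    by (rule cube_congruence_stack[OF e])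
  have 1: "1 \<in> {1..k}" using k by simp
  define A where "A = cc.grp 1"
  have carrier: "carrier A = X" unfolding A_def by (rule cc.grp_simps(1))
  \<comment> \<open>Commutativity takes two distinct directions; 1 and 2 are available since
    \<open>k\<close> is at least 2.\<close>
  have A: "comm_group A"
    unfolding A_def using k by (intro cc.comm_group_grp[of 1 2]) auto
  interpret A: comm_group A by (rule A)
  \<comment> \<open>\<open>T_eq_sum\<close> counts signs from the top vertex, \<open>alt\<close>
    from the bottom one; the exponent \<open>(-1) ^ k\<close> converts between them.\<close>
  have T: "cc.T f [^]\<^bsub>A\<^esub> ((-1) ^ k :: int)
      = finprod A (\<lambda>S. f S [^]\<^bsub>A\<^esub> ((-1) ^ card S :: int)) (Pow {1..k})"
    if f: "f \<in> Pow {1..k} \<rightarrow> X" for f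
  proof -
    have f': "f S \<in> carrier A" if "S \<subseteq> {1..k}" for S using f that carrier by auto
    have "cc.T f = finprod A (\<lambda>S. f S [^]\<^bsub>A\<^esub> ((-1) ^ card ({1..k} - S) :: int)) (Pow {1..k})"
      using cc.T_eq_sum[OF 1 A[unfolded A_def] f] by (simp only: A_def)
    then have "cc.T f [^]\<^bsub>A\<^esub> ((-1) ^ k :: int) = finprod A (\<lambda>S. (f S [^]\<^bsub>A\<^esub> ((-1) ^ card ({1..k} - S) :: int)) [^]\<^bsub>A\<^esub> ((-1) ^ k :: int)) (Pow {1..k})"
      using f' by (subst A.finprod_int_pow) auto
    also have "\<dots> = finprod A (\<lambda>S. f S [^]\<^bsub>A\<^esub> ((-1) ^ card S :: int)) (Pow {1..k})"
    proof (rule A.finprod_cong')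
      fix S assume "S \<in> Pow {1..k}"
      then have S: "S \<subseteq> {1..k}" by simp
      then have "card ({1..k} - S) + card S = k"
        using card_Diff_subset[of S "{1..k}"] card_mono[of "{1..k}" S] finite_subset[of S "{1..k}"] by simp
      then have "(-1) ^ card ({1..k} - S) * (-1) ^ k
          = (-1) ^ card ({1..k} - S) * (-1) ^ card ({1..k} - S) * ((-1) ^ card S :: int)"
        by (metis mult.assoc power_add)
      also have "\<dots> = (-1) ^ card S" by (simp flip: power_mult_distrib)
      finally show "(f S [^]\<^bsub>A\<^esub> ((-1) ^ card ({1..k} - S) :: int)) [^]\<^bsub>A\<^esub> ((-1) ^ k :: int)
        = f S [^]\<^bsub>A\<^esub> ((-1) ^ card S :: int)"
        by (simp only: A.int_pow_pow[OF f'[OF S]])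
    qed (use f' in auto)
    finally show ?thesis .
  qed
  have "alt A N c (vertices N) = \<one>\<^bsub>A\<^esub>" if c: "c \<in> C N" for c
  proof -
    define f where "f S = c (vec N S)" for S
    define g where "g S = f (insert N S)" for S
    have f_in: "f S \<in> carrier A" for S using cube_apply_in[OF c vec_in] by (simp add: f_def carrier)
    have fg: "f \<in> Pow {1..k} \<rightarrow> X" "g \<in> Pow {1..k} \<rightarrow> X" using f_in by (auto simp: g_def carrier)
    have "(\<lambda>v\<in>vertices N. f (supp N v)) = c"
    proof
      fix v show "(\<lambda>v\<in>vertices N. f (supp N v)) v = c v"
        using cube_in[OF c] vec_supp[of v N] by (auto simp: f_def PiE_iff extensional_def)
    qed
    then have "cub f" using c by (simp add: cub_def)
    moreover have "stack f g = f" by (auto simp: stack_def g_def insert_absorb)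
    \<comment> \<open>Here the cube \<open>c\<close> is used: it relates its two faces in direction
      \<open>N\<close>, so they have the same class.\<close>
    ultimately have Teq: "cc.T f = cc.T g" using cc.T_eq_iff[OF fg] by simp
    let ?P = "\<lambda>f. finprod A (\<lambda>S. f S [^]\<^bsub>A\<^esub> ((-1) ^ card S :: int)) (Pow {1..k})"
    let ?h = "\<lambda>S. f S [^]\<^bsub>A\<^esub> ((-1) ^ card S :: int)"
    have P_in: "?P f \<in> carrier A" using f_in by auto
    have NS: "N \<notin> S" if "S \<in> Pow {1..k}" for S using that by auto
    have "alt A N c (vertices N) = finprod A (\<lambda>S. c (vec N S) [^]\<^bsub>A\<^esub> ((-1) ^ height N (vec N S) :: int)) (Pow {1..N})"
      unfolding alt_def vec_image[symmetric]
      by (rule A.finprod_reindex[OF _ inj_on_vec]) (use cube_apply_in[OF c vec_in] carrier in auto)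
    also have "\<dots> = finprod A ?h (Pow {1..N})"
      by (rule A.finprod_cong') (use f_in height_vec in \<open>auto simp: f_def\<close>)
    also have "Pow {1..N} = Pow {1..k} \<union> insert N ` Pow {1..k}"
      using Pow_insert[of N "{1..k}"] by (simp add: atLeastAtMostSuc_conv)
    also have "finprod A ?h \<dots> = ?P f \<otimes>\<^bsub>A\<^esub> finprod A ?h (insert N ` Pow {1..k})"
      using f_in NS by (intro A.finprod_Un_disjoint) auto
    also have "finprod A ?h (insert N ` Pow {1..k}) = finprod A (\<lambda>S. ?h (insert N S)) (Pow {1..k})"
    proof (rule A.finprod_reindex)
      show "inj_on (insert N) (Pow {1..k})"
        using NS by (intro inj_onI) (metis insert_ident)
    qed (use f_in in auto)
    \<comment> \<open>Inserting \<open>N\<close> raises the cardinality by one, which inverts the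
      contribution of the face \<open>g\<close>.\<close>
    also have "\<dots> = finprod A (\<lambda>S. (g S [^]\<^bsub>A\<^esub> ((-1) ^ card S :: int)) [^]\<^bsub>A\<^esub> (-1 :: int)) (Pow {1..k})"
    proof (rule A.finprod_cong')
      fix S assume S: "S \<in> Pow {1..k}"
      then have "card (insert N S) = Suc (card S)"
        using NS[OF S] finite_subset[of S "{1..k}"] by (simp add: card_insert_disjoint)
      then show "?h (insert N S) = (g S [^]\<^bsub>A\<^esub> ((-1) ^ card S :: int)) [^]\<^bsub>A\<^esub> (-1 :: int)"
        using f_in by (simp add: g_def A.int_pow_pow)
    qed (use f_in in \<open>auto simp: g_def\<close>)
    also have "\<dots> = ?P g [^]\<^bsub>A\<^esub> (-1 :: int)"
      by (rule A.finprod_int_pow) (use f_in in \<open>auto simp: g_def\<close>)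
    also have "?P g = ?P f" using T[OF fg(1)] T[OF fg(2)] Teq by simp
    also have "?P f \<otimes>\<^bsub>A\<^esub> ?P f [^]\<^bsub>A\<^esub> (-1 :: int) = \<one>\<^bsub>A\<^esub>"
      using P_in by (simp add: A.int_pow_neg)
    finally show ?thesis .
  qed
  then show ?thesis using that A carrier by blast
qed

section \<open>Comparison with \<open>abelian_cubes\<close> in all dimensions\<close>

context
  fixes A :: "'a monoid"
  assumes A: "comm_group A" and carrier: "carrier A = X"
    and top: "\<And>c. c \<in> C N \<Longrightarrow> alt A N c (vertices N) = \<one>\<^bsub>A\<^esub>"
begin

interpretation A: comm_group A by (rule A)

lemma face_cube:
  "\<lbrakk>c \<in> C (Suc n); i \<in> {1..Suc n}; a = 0 \<or> a = 1\<rbrakk> \<Longrightarrow> compose (vertices n) c (face (Suc n) i a) \<in> C n"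
  by (rule presheaf[OF _ cube_morphism_face])

lemma cube_funcset: "c \<in> C n \<Longrightarrow> c \<in> vertices n \<rightarrow> carrier A"
  using cube_apply_in carrier by auto

text \<open>From dimension \<open>N\<close> upwards the sum splits into those over two opposite
  faces, which are cubes of one dimension less; both vanish by induction.\<close>

lemma alt_vertices:
  assumes "N \<le> n" "c \<in> C n"
  shows "alt A n c (vertices n) = \<one>\<^bsub>A\<^esub>"
  using assms
proof (induction arbitrary: c rule: dec_induct)
  case base
  then show ?case by (rule top)
next
  case (step n)
  have 1: "1 \<in> {1..Suc n}" by simp
  have c: "c \<in> vertices (Suc n) \<rightarrow> carrier A" by (rule cube_funcset[OF step.prems])
  let ?V = "\<lambda>a. {w \<in> vertices (Suc n). w 1 = a}"
  have V: "alt A (Suc n) c (?V a) = \<one>\<^bsub>A\<^esub>" if a: "a = 0 \<or> a = 1" for a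
    unfolding face_image[OF 1 a, symmetric] A.alt_face[OF 1 a order.refl c]
    using step.IH[OF face_cube[OF step.prems 1 a]] by simp
  have "vertices (Suc n) = ?V 0 \<union> ?V 1" using vertices_01[OF _ 1] by auto
  then have "alt A (Suc n) c (vertices (Suc n)) = alt A (Suc n) c (?V 0 \<union> ?V 1)" by simp
  also have "\<dots> = alt A (Suc n) c (?V 0) \<otimes>\<^bsub>A\<^esub> alt A (Suc n) c (?V 1)"
    unfolding alt_def using c finite_vertices[of "Suc n"]
    by (intro A.finprod_Un_disjoint) (auto intro!: A.int_pow_closed)
  finally show ?case using V by simp
qed

text \<open>At the all-one vertex the condition is \<open>alt_vertices\<close>. Any other vertex has
  a zero coordinate, so its condition already lives on a face and follows by induction.\<close>

lemma cube_abelian: "c \<in> C n \<Longrightarrow> c \<in> abelian_cubes k A n"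
proof (induction n arbitrary: c)
  case 0
  then show ?case
    using cube_in[OF 0] carrier by (auto simp: abelian_cubes_alt height_def)
next
  case (Suc n)
  have c: "c \<in> vertices (Suc n) \<rightarrow> carrier A" by (rule cube_funcset[OF Suc.prems])
  have "alt A (Suc n) c (below (Suc n) v) = \<one>\<^bsub>A\<^esub>"
    if v: "v \<in> vertices (Suc n)" and h: "k + 1 \<le> height (Suc n) v" for v
  proof (cases "v = all_one (Suc n)")
    case True
    then show ?thesis
      using alt_vertices[OF _ Suc.prems] h by (simp add: height_all_one below_all_one)
  next
    case False
    then obtain i where i: "i \<in> {1..Suc n}" "v i = 0" using not_all_one[OF v] by blast
    define u where "u = drop_coord n i v"
    have u: "u \<in> vertices n" using drop_coord_in[OF v] by (simp add: u_def)
    have vu: "v = face (Suc n) i 0 u" using face_drop_coord[OF i(1) v] i(2) by (simp add: u_def)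
    have "k + 1 \<le> height n u" using h height_face[OF i(1), of 0 u] vu by simp
    then have "alt A n (compose (vertices n) c (face (Suc n) i 0)) (below n u) = \<one>\<^bsub>A\<^esub>"
      using Suc.IH[OF face_cube[OF Suc.prems i(1)]] u by (simp add: abelian_cubes_alt)
    moreover have "below n u \<subseteq> vertices n" by (auto simp: below_def)
    ultimately show ?thesis
      unfolding vu below_face[OF i(1) u] using A.alt_face[OF i(1) _ _ c] by simp
  qed
  then show ?case using cube_in[OF Suc.prems] carrier by (simp add: abelian_cubes_alt)
qed

text \<open>The top value enters the sum with exponent 1 or -1, so it can be solved for once all
  other values are known.\<close>

lemma alt_determines_top:
  assumes f: "f \<in> vertices n \<rightarrow> carrier A" and g: "g \<in> vertices n \<rightarrow> carrier A"
    and eq: "\<And>v. v \<in> punctured_vertices n \<Longrightarrow> f v = g v"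
    and alt: "alt A n f (vertices n) = alt A n g (vertices n)"
  shows "f (all_one n) = g (all_one n)"
proof -
  let ?s = "(-1) ^ n :: int"
  let ?P = "\<lambda>f. alt A n f (punctured_vertices n)"
  have split: "alt A n h (vertices n) = h (all_one n) [^]\<^bsub>A\<^esub> ?s \<otimes>\<^bsub>A\<^esub> ?P h"
    if h: "h \<in> vertices n \<rightarrow> carrier A" for h
  proof -
    have "vertices n = insert (all_one n) (punctured_vertices n)"
      using all_one_in by (auto simp: punctured_vertices_def)
    moreover have "finite (punctured_vertices n)" "all_one n \<notin> punctured_vertices n"
      using finite_vertices by (auto simp: punctured_vertices_def)
    moreover have "h v [^]\<^bsub>A\<^esub> z \<in> carrier A" if "v \<in> vertices n" for v and z :: int
      using h that by auto
    ultimately show ?thesis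
      unfolding alt_def using A.finprod_insert[of "punctured_vertices n" "all_one n"]
      by (simp add: height_all_one Pi_def)
  qed
  have P_in: "?P h \<in> carrier A" if h: "h \<in> vertices n \<rightarrow> carrier A" for h
    unfolding alt_def using h by (intro A.finprod_closed) (auto simp: punctured_vertices_def)
  have "?P f = ?P g"
    unfolding alt_def using g eq
    by (intro A.finprod_cong') (auto simp: punctured_vertices_def)
  moreover have in_A: "f (all_one n) \<in> carrier A" "g (all_one n) \<in> carrier A"
    using f g all_one_in by auto
  ultimately have "f (all_one n) [^]\<^bsub>A\<^esub> ?s = g (all_one n) [^]\<^bsub>A\<^esub> ?s"
    using alt split[OF f] split[OF g] P_in[OF g] by simp
  \<comment> \<open>The exponent squares to 1, so applying it a second time removes it.\<close>
  then have "(f (all_one n) [^]\<^bsub>A\<^esub> ?s) [^]\<^bsub>A\<^esub> ?s = (g (all_one n) [^]\<^bsub>A\<^esub> ?s) [^]\<^bsub>A\<^esub> ?s"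
    by simp
  moreover have "?s * ?s = 1" by (simp flip: power_mult_distrib)
  ultimately show ?thesis using in_A by (simp add: A.int_pow_pow)
qed

text \<open>Passing to the face at 0 preserves heights, and lower sets correspond by
  \<open>below_face\<close>, so each condition on the face is one of those on
  \<open>f\<close>.\<close>

lemma face_abelian:
  assumes f: "f \<in> abelian_cubes k A (Suc n)" and i: "i \<in> {1..Suc n}"
  shows "compose (vertices n) f (face (Suc n) i 0) \<in> abelian_cubes k A n"
proof -
  have f': "f \<in> vertices (Suc n) \<rightarrow> carrier A" using f by (auto simp: abelian_cubes_def)
  have "alt A n (compose (vertices n) f (face (Suc n) i 0)) (below n u) = \<one>\<^bsub>A\<^esub>"
    if u: "u \<in> vertices n" and h: "k + 1 \<le> height n u" for u
  proof -
    have sub: "below n u \<subseteq> vertices n" by (auto simp: below_def)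
    have "alt A (Suc n) f (below (Suc n) (face (Suc n) i 0 u)) = \<one>\<^bsub>A\<^esub>"
      using f h face_in[OF i _ u] height_face[OF i, of 0 u] by (simp add: abelian_cubes_alt)
    moreover have "compose (vertices n) f (face (Suc n) i 0) v \<in> carrier A" if "v \<in> vertices n" for v
      using f' face_in[OF i _ that, of 0] that by (auto simp: compose_def)
    then have "alt A n (compose (vertices n) f (face (Suc n) i 0)) (below n u) \<in> carrier A"
      unfolding alt_def using sub by (intro A.finprod_closed) auto
    ultimately show ?thesis
      unfolding below_face[OF i u] using A.alt_face[OF i _ sub f', of 0] by simp
  qed
  moreover have "compose (vertices n) f (face (Suc n) i 0) \<in> vertices n \<rightarrow>\<^sub>E carrier A"
    using f' face_in[OF i, of 0] by (auto simp: compose_def)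
  ultimately show ?thesis by (simp add: abelian_cubes_alt)
qed

text \<open>Up to dimension \<open>k\<close> every map is a cube. Above it, the faces of
  \<open>f\<close> at 0 are cubes by induction, so \<open>f\<close> restricts to a corner. The
  completion of this corner satisfies the same sum condition by \<open>cube_abelian\<close>, hence
  agrees with \<open>f\<close> at the top vertex as well.\<close>

lemma abelian_cube: "f \<in> abelian_cubes k A n \<Longrightarrow> f \<in> C n"
proof (induction n arbitrary: f)
  case 0
  then show ?case using full[of 0] carrier by (simp add: abelian_cubes_def)
next
  case (Suc n)
  have fE: "f \<in> vertices (Suc n) \<rightarrow>\<^sub>E X" using Suc.prems carrier by (simp add: abelian_cubes_def)
  show ?case
  proof (cases "Suc n \<le> k")
    case True
    then show ?thesis using full fE by simp
  next
    case False
    let ?f = "restrict f (punctured_vertices (Suc n))"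
    have one: "all_one (Suc n) i = 1" if "i \<in> {1..Suc n}" for i using that by (simp add: all_one_def)
    have "corner X C (Suc n) ?f"
      unfolding corner_def
    proof (intro conjI ballI)
      show "?f \<in> punctured_vertices (Suc n) \<rightarrow>\<^sub>E X"
        using fE by (auto simp: punctured_vertices_def)
      fix i assume i: "i \<in> {1..Suc n}"
      have "face (Suc n) i 0 v \<in> punctured_vertices (Suc n)" if "v \<in> vertices n" for v
        using face_in[OF i _ that, of 0] face_at[OF i, of 0 v] one[OF i]
        by (auto simp: punctured_vertices_def)
      then have "compose (vertices n) ?f (face (Suc n) i 0) = compose (vertices n) f (face (Suc n) i 0)"
        by (simp add: compose_def cong: restrict_cong)
      then show "compose (vertices (Suc n - 1)) ?f (face (Suc n) i 0) \<in> C (Suc n - 1)"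
        using Suc.IH[OF face_abelian[OF Suc.prems i]] by simp
    qed
    then obtain \<phi> where "completes C (Suc n) ?f \<phi>" using completion by blast
    then have \<phi>: "\<phi> \<in> C (Suc n)" "restrict \<phi> (punctured_vertices (Suc n)) = ?f"
      by (auto simp: completes_def)
    have eq: "f v = \<phi> v" if "v \<in> punctured_vertices (Suc n)" for v
      using \<phi>(2) that by (metis restrict_apply')
    \<comment> \<open>Here \<open>Suc n\<close> is at least \<open>k + 1\<close>, so the all-one
      vertex is among those where the sum is required to vanish.\<close>
    have top0: "alt A (Suc n) h (vertices (Suc n)) = \<one>\<^bsub>A\<^esub>" if "h \<in> abelian_cubes k A (Suc n)" for h
      using that False all_one_in[of "Suc n"] height_all_one[of "Suc n"] below_all_one[of "Suc n"]
      by (auto simp: abelian_cubes_alt)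
    have "f (all_one (Suc n)) = \<phi> (all_one (Suc n))"
    proof (rule alt_determines_top)
      show "f \<in> vertices (Suc n) \<rightarrow> carrier A" using fE carrier by auto
      show "\<phi> \<in> vertices (Suc n) \<rightarrow> carrier A" by (rule cube_funcset[OF \<phi>(1)])
      show "alt A (Suc n) f (vertices (Suc n)) = alt A (Suc n) \<phi> (vertices (Suc n))"
        using top0[OF Suc.prems] top0[OF cube_abelian[OF \<phi>(1)]] by simp
    qed (rule eq)
    with eq have "f v = \<phi> v" if "v \<in> vertices (Suc n)" for v
      using that by (cases "v = all_one (Suc n)") (auto simp: punctured_vertices_def)
    then have "f = \<phi>" using fE cube_in[OF \<phi>(1)] by (intro PiE_ext) auto
    then show ?thesis using \<phi>(1) by simp
  qed
qed

text \<open>The group was built on \<open>X\<close> itself, so the identity map serves as the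
  isomorphism.\<close>

lemma isomorphic_abelian_cubes: "cube_isomorphic X C (carrier A) (abelian_cubes k A)"
  unfolding cube_isomorphic_def
proof (intro exI[of _ id] conjI allI ballI)
  show "bij_betw id X (carrier A)" by (simp add: carrier)
  fix n and c :: "(nat \<Rightarrow> nat) \<Rightarrow> 'a" assume "c \<in> vertices n \<rightarrow>\<^sub>E X"
  then have "compose (vertices n) id c = c"
    by (auto simp: compose_def PiE_iff extensional_def)
  then show "c \<in> C n \<longleftrightarrow> compose (vertices n) id c \<in> abelian_cubes k A n"
    using cube_abelian abelian_cube by auto
qed

end

end

theorem theorem13p2:
  fixes X :: "'a set" and C :: "nat \<Rightarrow> ((nat \<Rightarrow> nat) \<Rightarrow> 'a) set" and k :: nat
  assumes "k \<ge> 2"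
    and "groupspace X C"
    and "k_step k X C"
    and "k_ergodic k X C"
  shows "\<exists>A :: 'a monoid. comm_group A \<and>
           cube_isomorphic X C (carrier A) (abelian_cubes k A)"
proof -
  interpret ergodic_step_groupspace X C k
    using assms by (intro ergodic_step_groupspace.intro ergodic_step_groupspace_axioms.intro)
  show ?thesis
    using exists_group[OF assms(1)] isomorphic_abelian_cubes by metis
qed

end
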